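(* For every $\mu>0$ there is a critical temperature $\theta_c=\theta_c(\mu)>0$, which is always positive, such that for all $\theta\ge\theta_c$ the minimizer $(W,\delta)$ of $g_\theta$ over $W\ge0$, $\delta\ge0$ satisfies $\delta=0$, whereas for all $\theta<\theta_c$ it satisfies $\delta>0$. Moreover, in the large $\mu$ limit, $$\theta_c(\mu)\sim C\exp\left(-\frac{\pi}{4}\mu\right)\quad\text{as }\mu\to\infty,\qquad\text{with } C\approx0.61385.$$
   Context: For $\mu>0$ and temperature $\theta>0$, the thermodynamic-limit Peierls free energy per atom is, for $W\ge0$, $\delta\ge0$, $$g_\theta(W,\delta)=\frac{\mu}{2}\left[(W-1)^2+\delta^2\right]-\frac{1}{2\pi}\int_0^{2\pi}h_\theta\left(4W^2\cos^2(s)+4\delta^2\sin^2(s)\right)ds,$$ where $h_\theta(x)=2\theta\ln\big(2\cosh(\tfrac{\sqrt x}{2\theta})\big)$ for $x\ge0$.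
   Formalization: The printed value C≈0.61385 is off in its fifth decimal: the constant is C = 8·exp(γ−2)/π = 0.613808…; the formal statement asserts |C − 0.61385| < 5·10⁻⁵ instead of agreement to all five printed digits. *)

theory Defs
  imports "HOL-Analysis.Analysis" "HOL-Library.Landau_Symbols"
begin

definition peierls_h :: "real \<Rightarrow> real \<Rightarrow> real" where
  "peierls_h \<theta> x = 2 * \<theta> * ln (2 * cosh (sqrt x / (2 * \<theta>)))"

definition peierls_g :: "real \<Rightarrow> real \<Rightarrow> real \<Rightarrow> real \<Rightarrow> real" where
  "peierls_g \<mu> \<theta> W \<delta> =
     \<mu> / 2 * ((W - 1)\<^sup>2 + \<delta>\<^sup>2)
     - 1 / (2 * pi) *
       integral {0..2 * pi} (\<lambda>s. peierls_h \<theta> (4 * W\<^sup>2 * (cos s)\<^sup>2 + 4 * \<delta>\<^sup>2 * (sin s)\<^sup>2))"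

definition is_peierls_minimizer :: "real \<Rightarrow> real \<Rightarrow> real \<times> real \<Rightarrow> bool" where
  "is_peierls_minimizer \<mu> \<theta> =
     is_arg_min (\<lambda>(W, \<delta>). peierls_g \<mu> \<theta> W \<delta>) (\<lambda>(W, \<delta>). W \<ge> 0 \<and> \<delta> \<ge> 0)"

end

theory Submission
  imports Defs "HOL-Real_Asymp.Real_Asymp"
begin

text \<open>In the variables \<open>(W\<^sup>2, \<delta>\<^sup>2)\<close> the energy is strictly convex, so its minimizer is
  unique and \<open>(W, 0)\<close> is the minimizer as soon as it is stationary in \<open>W\<close> and the one-sided
  derivative in \<open>\<delta>\<^sup>2\<close> is nonnegative. With \<open>T = \<theta> / W\<close> the first condition makes \<open>\<theta>\<close> an
  increasing function of \<open>T\<close>, and the second becomes \<open>J T \<le> \<mu> / 2\<close>, where \<open>J T\<close> is the mean over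
  the circle of \<open>(sin\<^sup>2 s - cos\<^sup>2 s) tanh (cos s / T) / cos s\<close>, a function that decreases from
  \<open>\<infinity>\<close> to \<open>0\<close>. Hence there is exactly one critical temperature. As \<open>T \<rightarrow> 0\<close>,
  \<open>J T = 2 / \<pi> * (ln (1 / T) + \<gamma> + ln (8 / \<pi>) - 2) + o(1)\<close>, because the integral of
  \<open>tanh v / v\<close> over \<open>[0, X]\<close> is \<open>ln X + \<gamma> + ln (4 / \<pi>) + o(1)\<close>. This gives
  \<open>C = 8 exp (\<gamma> - 2) / \<pi>\<close>.\<close>

subsection \<open>The function \<open>tanh x / x\<close>\<close>

definition tanhc :: "real \<Rightarrow> real" where
  "tanhc x = (if x = 0 then 1 else tanh x / x)"

lemma tanhc_0 [simp]: "tanhc 0 = 1"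
  by (simp add: tanhc_def)

lemma tanhc_minus [simp]: "tanhc (- x) = tanhc x"
  by (simp add: tanhc_def)

lemma tanhc_abs [simp]: "tanhc \<bar>x\<bar> = tanhc x"
  by (simp add: abs_if)

lemma mult_tanhc: "x * tanhc x = tanh x"
  by (simp add: tanhc_def)

lemma tanhc_pos: "tanhc x > 0"
  by (auto simp: tanhc_def zero_less_divide_iff)

lemma isCont_tanhc: "isCont tanhc x"
proof (cases "x = 0")
  case True
  have "(tanh has_field_derivative 1) (at (0::real))"
    by (auto intro!: derivative_eq_intros)
  then have "((\<lambda>h. tanh h / h) \<longlongrightarrow> 1) (at (0::real))"
    by (simp add: DERIV_def)
  then have "(tanhc \<longlongrightarrow> 1) (at 0)"
    by (rule Lim_transform_eventually) (auto simp: tanhc_def eventually_at_filter)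
  then show ?thesis
    using True by (simp add: isCont_def)
next
  case False
  have "isCont (\<lambda>x. tanh x / x) x"
    using False by (intro continuous_intros) auto
  moreover have "eventually (\<lambda>y. tanh y / y = tanhc y) (nhds x)"
    using t1_space_nhds[OF False] by eventually_elim (simp add: tanhc_def)
  ultimately show ?thesis
    using isCont_cong[of "\<lambda>y. tanh y / y" tanhc x] by simp
qed

lemma continuous_on_tanhc [continuous_intros]:
  assumes "continuous_on S f"
  shows "continuous_on S (\<lambda>x. tanhc (f x))"
  using continuous_on_compose2[OF continuous_at_imp_continuous_on[of UNIV tanhc] assms]
  by (auto simp: isCont_tanhc)

text \<open>The function below is \<open>x\<^sup>2 * tanhc' x\<close>.\<close>

lemma tanhc_deriv_numerator_less:
  fixes x y :: real
  assumes "0 \<le> x" "x < y"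
  shows "y * (1 - (tanh y)\<^sup>2) - tanh y < x * (1 - (tanh x)\<^sup>2) - tanh x"
proof (rule DERIV_neg_imp_decreasing_open[OF assms(2)])
  fix z assume z: "x < z" "z < y"
  show "\<exists>d. ((\<lambda>z. z * (1 - (tanh z)\<^sup>2) - tanh z) has_real_derivative d) (at z) \<and> d < 0"
  proof (intro exI conjI)
    show "((\<lambda>z. z * (1 - (tanh z)\<^sup>2) - tanh z) has_real_derivative
      - (2 * z * tanh z * (1 - (tanh z)\<^sup>2))) (at z)"
      by (auto intro!: derivative_eq_intros simp: algebra_simps power2_eq_square)
    have "\<bar>tanh z\<bar> < 1" using tanh_real_bounds[of z] by auto
    then have "(tanh z)\<^sup>2 < 1" by (simp add: abs_square_less_1)
    then show "- (2 * z * tanh z * (1 - (tanh z)\<^sup>2)) < 0"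
      using z assms by simp
  qed
qed (auto intro!: continuous_intros)

lemma has_real_derivative_tanhc:
  assumes "x \<noteq> 0"
  shows "(tanhc has_real_derivative (x * (1 - (tanh x)\<^sup>2) - tanh x) / x\<^sup>2) (at x)"
proof -
  have *: "((\<lambda>x. tanh x / x) has_real_derivative (x * (1 - (tanh x)\<^sup>2) - tanh x) / x\<^sup>2) (at x)"
    using assms by (auto intro!: derivative_eq_intros simp: field_simps power2_eq_square)
  show ?thesis
    by (rule DERIV_cong_ev[THEN iffD1, OF refl _ refl *])
       (use t1_space_nhds[OF assms] in eventually_elim, simp add: tanhc_def)
qed

text \<open>The numerator of the derivative vanishes at 0 and strictly decreases, so the derivative
  is negative at every positive point.\<close>

lemma tanhc_less:
  assumes "0 \<le> x" "x < y"
  shows "tanhc y < tanhc x"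
proof (rule DERIV_neg_imp_decreasing_open[OF assms(2)])
  fix z assume z: "x < z" "z < y"
  have "z * (1 - (tanh z)\<^sup>2) - tanh z < 0"
    using tanhc_deriv_numerator_less[of 0 z] z assms by simp
  then show "\<exists>d. (tanhc has_real_derivative d) (at z) \<and> d < 0"
    using z assms has_real_derivative_tanhc[of z]
    by (intro exI[of _ "(z * (1 - (tanh z)\<^sup>2) - tanh z) / z\<^sup>2"]) (auto simp: divide_neg_pos)
qed (auto intro!: continuous_intros)

lemma tanhc_le:
  assumes "0 \<le> x" "x \<le> y"
  shows "tanhc y \<le> tanhc x"
  using tanhc_less[OF assms(1)] assms(2) by (cases "x = y") (auto simp: less_imp_le)

lemma tanhc_le_1: "tanhc x \<le> 1"
  using tanhc_le[of 0 "\<bar>x\<bar>"] by simp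

text \<open>Rescaled by T, this is the source of the low-temperature error bound in
  \<open>x_tanh_x_bounds\<close>.\<close>

lemma mult_one_minus_tanh_le_1:
  fixes x :: real
  assumes "0 \<le> x"
  shows "x * (1 - tanh x) \<le> 1"
proof -
  have "1 - tanh x = 2 / (exp (2 * x) + 1)"
  proof -
    have "exp (2 * x) + 1 > 0" by (simp add: add_pos_pos)
    then show ?thesis
      by (simp add: tanh_real_altdef exp_minus divide_simps)
  qed
  also have "x * \<dots> \<le> 1"
  proof -
    have "x * 2 \<le> exp (2 * x) + 1" "exp (2 * x) + 1 > 0"
      using exp_ge_add_one_self[of "2 * x"] by (auto intro: add_pos_pos simp del: exp_ge_add_one_self)
    then show ?thesis by (simp add: pos_divide_le_eq)
  qed
  finally show ?thesis .
qed

subsection \<open>The tangent line inequality\<close>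

text \<open>The derivative of \<open>peierls_h\<close> in x. Written through \<open>tanhc\<close> it
  also has a continuous value at x = 0, where sqrt is not differentiable.\<close>

definition peierls_h' :: "real \<Rightarrow> real \<Rightarrow> real" where
  "peierls_h' \<theta> x = tanhc (sqrt x / (2 * \<theta>)) / (4 * \<theta>)"

lemma continuous_on_peierls_h [continuous_intros]:
  assumes "continuous_on S f"
  shows "continuous_on S (\<lambda>x. peierls_h \<theta> (f x))"
  unfolding peierls_h_def cosh_def
  by (cases "\<theta> = 0") (auto intro!: continuous_intros assms simp: add_pos_pos less_imp_neq[symmetric])

lemma continuous_on_peierls_h' [continuous_intros]:
  assumes "continuous_on S f"
  shows "continuous_on S (\<lambda>x. peierls_h' \<theta> (f x))"
  unfolding peierls_h'_def divide_inverse by (intro continuous_intros assms)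

lemma has_real_derivative_peierls_h:
  assumes "\<theta> > 0" "x > 0"
  shows "(peierls_h \<theta> has_real_derivative peierls_h' \<theta> x) (at x)"
proof -
  define t where "t = sqrt x / (2 * \<theta>)"
  have t: "t > 0" and st: "sqrt x = 2 * \<theta> * t" using assms by (auto simp: t_def)
  have "((\<lambda>x. 2 * \<theta> * ln (2 * cosh (sqrt x / (2 * \<theta>)))) has_real_derivative
    2 * \<theta> * (1 / (2 * cosh t) * (2 * (sinh t * (inverse (sqrt x) / 2 / (2 * \<theta>)))))) (at x)"
    unfolding t_def using assms
    by (auto intro!: derivative_eq_intros)
  moreover have "2 * \<theta> * (1 / (2 * cosh t) * (2 * (sinh t * (inverse (sqrt x) / 2 / (2 * \<theta>)))))
    = peierls_h' \<theta> x"
    using t assms(1) unfolding peierls_h'_def t_def[symmetric] tanhc_def tanh_def st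
    by (simp add: divide_simps)
  ultimately show ?thesis
    unfolding peierls_h_def[abs_def] by simp
qed

text \<open>Strict decrease of the derivative is strict concavity of \<open>peierls_h\<close>,
  inherited from \<open>tanhc\<close>.\<close>

lemma peierls_h'_less:
  assumes "\<theta> > 0" "0 \<le> x" "x < y"
  shows "peierls_h' \<theta> y < peierls_h' \<theta> x"
  unfolding peierls_h'_def using assms
  by (intro divide_strict_right_mono tanhc_less) (auto intro!: divide_strict_right_mono)

text \<open>Strict concavity through the mean value theorem. Only interior points need a derivative,
  so x = 0 or y = 0 is allowed; this matters because \<open>peierls_arg W 0 s\<close> vanishes where
  cos s = 0.\<close>

lemma peierls_h_less_tangent:
  assumes "\<theta> > 0" "0 \<le> x" "0 \<le> y" "x \<noteq> y"
  shows "peierls_h \<theta> y < peierls_h \<theta> x + peierls_h' \<theta> x * (y - x)"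
proof -
  have mvt: "\<exists>z. a < z \<and> z < b \<and> peierls_h \<theta> b - peierls_h \<theta> a = (b - a) * peierls_h' \<theta> z"
    if ab: "0 \<le> a" "a < b" for a b
  proof -
    have "continuous_on {a..b} (peierls_h \<theta>)"
      using continuous_on_peierls_h[OF continuous_on_id] by simp
    then obtain z where "a < z" "z < b"
      "peierls_h \<theta> b - peierls_h \<theta> a = (\<lambda>d. d * peierls_h' \<theta> z) (b - a)"
    proof (rule mvt[OF ab(2)])
      fix z assume "a < z" "z < b"
      then show "(peierls_h \<theta> has_derivative (\<lambda>d. d * peierls_h' \<theta> z)) (at z)"
        using has_real_derivative_peierls_h[OF assms(1), of z] ab(1)
        by (simp add: has_field_derivative_def mult_commute_abs)
    qed
    then show ?thesis by blast
  qed
  show ?thesis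
  proof (cases "x < y")
    case True
    then obtain z where z: "x < z" "z < y" "peierls_h \<theta> y - peierls_h \<theta> x = (y - x) * peierls_h' \<theta> z"
      using mvt assms by blast
    then have "(y - x) * peierls_h' \<theta> z < (y - x) * peierls_h' \<theta> x"
      using True assms peierls_h'_less by (intro mult_strict_left_mono) auto
    then show ?thesis using z(3) unfolding mult.commute[of _ "y - x"] by linarith
  next
    case False
    then obtain z where z: "y < z" "z < x" "peierls_h \<theta> x - peierls_h \<theta> y = (x - y) * peierls_h' \<theta> z"
      using mvt[of y x] assms by fastforce
    then have "(x - y) * peierls_h' \<theta> z > (x - y) * peierls_h' \<theta> x"
      using False assms peierls_h'_less by (intro mult_strict_left_mono) auto
    then show ?thesis using z by (simp add: algebra_simps)
  qed
qed

lemma peierls_h_le_tangent: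
  assumes "\<theta> > 0" "0 \<le> x" "0 \<le> y"
  shows "peierls_h \<theta> y \<le> peierls_h \<theta> x + peierls_h' \<theta> x * (y - x)"
  using peierls_h_less_tangent[OF assms] by (cases "x = y") auto

text \<open>Since cosh t \<le> exp t for t \<ge> 0, the electronic term grows at most linearly in W
  and \<delta>, and the quadratic elastic term dominates it.\<close>

lemma peierls_h_le:
  assumes "\<theta> > 0" "0 \<le> x"
  shows "peierls_h \<theta> x \<le> sqrt x + 2 * \<theta> * ln 2"
proof -
  define t where "t = sqrt x / (2 * \<theta>)"
  have "t \<ge> 0" using assms by (simp add: t_def)
  then have "2 * cosh t \<le> 2 * exp t" by (simp add: cosh_def field_simps)
  then have "ln (2 * cosh t) \<le> ln (2 * exp t)" by (subst ln_le_cancel_iff) auto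
  also have "\<dots> = t + ln 2" by (simp add: ln_mult)
  finally have "2 * \<theta> * ln (2 * cosh t) \<le> 2 * \<theta> * (t + ln 2)"
    using assms by (intro mult_left_mono) auto
  moreover have "2 * \<theta> * t = sqrt x" using assms by (simp add: t_def)
  ultimately show ?thesis by (simp add: peierls_h_def t_def[symmetric] distrib_left)
qed

subsection \<open>Existence and uniqueness of the minimizer\<close>

definition circ_mean :: "(real \<Rightarrow> real) \<Rightarrow> real" where
  "circ_mean f = integral {0..2 * pi} f / (2 * pi)"

lemma circ_mean_const [simp]: "circ_mean (\<lambda>_. c) = c"
  by (simp add: circ_mean_def)

lemma circ_mean_cmult: "circ_mean (\<lambda>s. c * f s) = c * circ_mean f"
  by (simp add: circ_mean_def)

lemma circ_mean_add:
  assumes "continuous_on {0..2 * pi} f" "continuous_on {0..2 * pi} g"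
  shows "circ_mean (\<lambda>s. f s + g s) = circ_mean f + circ_mean g"
  using assms
  by (simp add: circ_mean_def integral_add integrable_continuous_real add_divide_distrib)

lemma circ_mean_diff:
  assumes "continuous_on {0..2 * pi} f" "continuous_on {0..2 * pi} g"
  shows "circ_mean (\<lambda>s. f s - g s) = circ_mean f - circ_mean g"
  using assms
  by (simp add: circ_mean_def integral_diff integrable_continuous_real diff_divide_distrib)

lemma circ_mean_mono:
  assumes "continuous_on {0..2 * pi} f" "continuous_on {0..2 * pi} g"
    and "\<And>s. f s \<le> g s"
  shows "circ_mean f \<le> circ_mean g"
  unfolding circ_mean_def using assms
  by (intro divide_right_mono integral_le) (auto simp: integrable_continuous_real)

text \<open>A continuous nonnegative function with integral zero vanishes, so strict inequality at a
  single point suffices.\<close>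

lemma circ_mean_strict_mono:
  assumes "continuous_on {0..2 * pi} f" "continuous_on {0..2 * pi} g"
    and le: "\<And>s. f s \<le> g s" and s: "s \<in> {0..2 * pi}" "f s < g s"
  shows "circ_mean f < circ_mean g"
proof -
  have "circ_mean f \<noteq> circ_mean g"
  proof
    assume "circ_mean f = circ_mean g"
    then have "integral {0..2 * pi} (\<lambda>s. g s - f s) = 0"
      using assms by (simp add: circ_mean_def integral_diff integrable_continuous_real)
    then have "\<forall>s\<in>{0..2 * pi}. g s - f s = 0"
      using assms by (subst (asm) integral_eq_0_iff) (auto intro!: continuous_intros)
    then show False using s by auto
  qed
  then show ?thesis using circ_mean_mono[OF assms(1,2) le] by simp
qed

lemma continuous_on_circ_mean:
  assumes "continuous_on (U \<times> {0..2 * pi}) (\<lambda>(x, s). f x s)"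
  shows "continuous_on U (\<lambda>x. circ_mean (f x))"
  unfolding circ_mean_def
  using integral_continuous_on_param[of U 0 "2 * pi" f] assms
  by (auto intro!: continuous_intros)

text \<open>Linear in the squares of W and \<delta>, so that the concavity of
  \<open>peierls_h\<close> carries over to these two squares.\<close>

definition peierls_arg :: "real \<Rightarrow> real \<Rightarrow> real \<Rightarrow> real" where
  "peierls_arg W \<delta> s = 4 * W\<^sup>2 * (cos s)\<^sup>2 + 4 * \<delta>\<^sup>2 * (sin s)\<^sup>2"

lemma peierls_arg_nonneg [simp]: "peierls_arg W \<delta> s \<ge> 0"
  by (simp add: peierls_arg_def)

lemma continuous_on_peierls_arg [continuous_intros]:
  fixes f :: "'a::t2_space \<Rightarrow> real"
  assumes "continuous_on S u" "continuous_on S v" "continuous_on S f"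
  shows "continuous_on S (\<lambda>x. peierls_arg (u x) (v x) (f x))"
  unfolding peierls_arg_def by (intro continuous_intros assms)

lemma peierls_g_eq:
  "peierls_g \<mu> \<theta> W \<delta> =
     \<mu> / 2 * ((W - 1)\<^sup>2 + \<delta>\<^sup>2) - circ_mean (\<lambda>s. peierls_h \<theta> (peierls_arg W \<delta> s))"
  by (simp add: peierls_g_def circ_mean_def peierls_arg_def)

lemma continuous_on_peierls_g:
  "continuous_on U (\<lambda>(W, \<delta>). peierls_g \<mu> \<theta> W \<delta>)"
  unfolding peierls_g_eq case_prod_unfold
  by (intro continuous_intros continuous_on_circ_mean) (auto simp: case_prod_unfold intro!: continuous_intros)

lemma is_peierls_minimizer_iff:
  "is_peierls_minimizer \<mu> \<theta> (W, \<delta>) \<longleftrightarrow> W \<ge> 0 \<and> \<delta> \<ge> 0 \<and>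
     (\<forall>W' \<delta>'. W' \<ge> 0 \<longrightarrow> \<delta>' \<ge> 0 \<longrightarrow> peierls_g \<mu> \<theta> W \<delta> \<le> peierls_g \<mu> \<theta> W' \<delta>')"
  by (auto simp: is_peierls_minimizer_def is_arg_min_linorder)

lemma peierls_g_lower_bound:
  assumes "\<theta> > 0" "W \<ge> 0" "\<delta> \<ge> 0"
  shows "peierls_g \<mu> \<theta> W \<delta> \<ge> \<mu> / 2 * ((W - 1)\<^sup>2 + \<delta>\<^sup>2) - 2 * (W + \<delta>) - 2 * \<theta> * ln 2"
proof -
  have "circ_mean (\<lambda>s. peierls_h \<theta> (peierls_arg W \<delta> s)) \<le> circ_mean (\<lambda>s. 2 * (W + \<delta>) + 2 * \<theta> * ln 2)"
  proof (rule circ_mean_mono)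
    fix s
    have "peierls_arg W \<delta> s \<le> 4 * W\<^sup>2 * 1 + 4 * \<delta>\<^sup>2 * 1"
      unfolding peierls_arg_def
      by (intro add_mono mult_left_mono) (auto simp: abs_square_le_1)
    also have "\<dots> \<le> (2 * (W + \<delta>))\<^sup>2"
      using assms by (simp add: power2_eq_square algebra_simps)
    finally have "sqrt (peierls_arg W \<delta> s) \<le> 2 * (W + \<delta>)"
      using assms by (simp add: real_le_lsqrt)
    then show "peierls_h \<theta> (peierls_arg W \<delta> s) \<le> 2 * (W + \<delta>) + 2 * \<theta> * ln 2"
      using peierls_h_le[OF assms(1) peierls_arg_nonneg, of W \<delta> s] by simp
  qed (auto intro!: continuous_intros)
  then show ?thesis by (simp add: peierls_g_eq)
qed

lemma quadratic_lower_bound: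
  fixes \<mu> c x :: real
  assumes "\<mu> > 0"
  shows "\<mu> / 2 * x\<^sup>2 - c * x \<ge> - (c\<^sup>2 / (2 * \<mu>))"
proof -
  have "0 \<le> (\<mu> * x - c)\<^sup>2 / (2 * \<mu>)" using assms by simp
  also have "\<dots> = \<mu> / 2 * x\<^sup>2 - c * x + c\<^sup>2 / (2 * \<mu>)"
    using assms by (simp add: field_simps power2_eq_square)
  finally show ?thesis by simp
qed

text \<open>The energy is coercive: outside a square it exceeds its value at the origin, and inside
  the square continuity and compactness give a minimizer.\<close>

lemma peierls_minimizer_exists:
  assumes "\<mu> > 0" "\<theta> > 0"
  shows "\<exists>p. is_peierls_minimizer \<mu> \<theta> p"
proof -
  \<comment> \<open>Expanding the lower bound gives the linear term - (\<mu> + 2) * W; for \<delta>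
    it is only - 2 * \<delta>, and the surplus \<open>\<mu> * \<delta>\<close> is nonnegative.
    Beyond \<open>R\<close> one coordinate contributes more than
    \<open>c\<^sup>2 / (2 * \<mu>)\<close>, which is the most that the other can take away.\<close>
  define c where "c = \<mu> + 2"
  define R where "R = 4 * c / \<mu>"
  have c: "c > 0" and R: "R \<ge> 0" "\<mu> * R = 4 * c" using assms by (auto simp: c_def R_def)
  have far: "\<mu> / 2 * x\<^sup>2 - c * x > c\<^sup>2 / (2 * \<mu>)" if "x > R" for x
  proof -
    have "\<mu> * x > 4 * c" using mult_strict_left_mono[OF that assms(1)] R by simp
    then have "c < \<mu> / 2 * x - c" using c by simp
    then have "x * (\<mu> / 2 * x - c) > R * c"
      using that R c by (intro mult_strict_mono) auto
    moreover have "R * c = 8 * (c\<^sup>2 / (2 * \<mu>))"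
      using assms by (simp add: R_def power2_eq_square)
    moreover have "c\<^sup>2 / (2 * \<mu>) > 0" using assms c by simp
    moreover have "x * (\<mu> / 2 * x - c) = \<mu> / 2 * x\<^sup>2 - c * x"
      by (simp add: algebra_simps power2_eq_square)
    ultimately show ?thesis by linarith
  qed
  have out: "peierls_g \<mu> \<theta> 0 0 < peierls_g \<mu> \<theta> W \<delta>"
    if "W \<ge> 0" "\<delta> \<ge> 0" "W > R \<or> \<delta> > R" for W \<delta>
  proof -
    have "(\<mu> / 2 * W\<^sup>2 - c * W) + (\<mu> / 2 * \<delta>\<^sup>2 - c * \<delta>) > 0"
      using that(3) far[of W] far[of \<delta>] quadratic_lower_bound[OF assms(1), where x = W and c = c]
        quadratic_lower_bound[OF assms(1), where x = \<delta> and c = c] by linarith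
    moreover have "\<mu> * \<delta> \<ge> 0" using assms that by simp
    moreover have "peierls_g \<mu> \<theta> 0 0 = \<mu> / 2 - 2 * \<theta> * ln 2"
      by (simp add: peierls_g_eq peierls_arg_def peierls_h_def)
    moreover have "\<mu> / 2 * ((W - 1)\<^sup>2 + \<delta>\<^sup>2) - 2 * (W + \<delta>)
      = (\<mu> / 2 * W\<^sup>2 - c * W) + (\<mu> / 2 * \<delta>\<^sup>2 - c * \<delta>) + \<mu> / 2 + \<mu> * \<delta>"
      by (simp add: c_def power2_eq_square field_simps)
    ultimately show ?thesis
      using peierls_g_lower_bound[OF assms(2) that(1,2), of \<mu>] by linarith
  qed
  have "compact ({0..R} \<times> {0..R})" "{0..R} \<times> {0..R} \<noteq> {}"
    using R by (auto intro!: compact_Times)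
  from continuous_attains_inf[OF this continuous_on_peierls_g, of \<mu> \<theta>]
  obtain p where p: "p \<in> {0..R} \<times> {0..R}"
    "\<And>q. q \<in> {0..R} \<times> {0..R} \<Longrightarrow> (\<lambda>(W, \<delta>). peierls_g \<mu> \<theta> W \<delta>) p \<le> (\<lambda>(W, \<delta>). peierls_g \<mu> \<theta> W \<delta>) q"
    by blast
  obtain W \<delta> where Wd: "p = (W, \<delta>)" by (cases p)
  have "peierls_g \<mu> \<theta> W \<delta> \<le> peierls_g \<mu> \<theta> W' \<delta>'" if "W' \<ge> 0" "\<delta>' \<ge> 0" for W' \<delta>'
  proof (cases "W' > R \<or> \<delta>' > R")
    case True
    then show ?thesis using out[OF that] p(2)[of "(0, 0)"] Wd R by auto
  next
    case False
    then show ?thesis using p(2)[of "(W', \<delta>')"] Wd that by auto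
  qed
  then have "is_peierls_minimizer \<mu> \<theta> (W, \<delta>)"
    using p(1) Wd by (auto simp: is_peierls_minimizer_iff)
  then show ?thesis by blast
qed

text \<open>Two minimizers are compared with their midpoint in the squares of the variables. There
  \<open>peierls_h\<close> is strictly concave and the elastic part is convex, so the midpoint would
  have energy strictly below their average.\<close>

lemma peierls_minimizer_unique:
  assumes "\<mu> > 0" "\<theta> > 0"
    and 1: "is_peierls_minimizer \<mu> \<theta> (W1, \<delta>1)" and 2: "is_peierls_minimizer \<mu> \<theta> (W2, \<delta>2)"
  shows "(W1, \<delta>1) = (W2, \<delta>2)"
proof (rule ccontr)
  assume neq: "(W1, \<delta>1) \<noteq> (W2, \<delta>2)"
  have nonneg: "W1 \<ge> 0" "W2 \<ge> 0" "\<delta>1 \<ge> 0" "\<delta>2 \<ge> 0"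
    using 1 2 by (auto simp: is_peierls_minimizer_iff)
  define W where "W = sqrt ((W1\<^sup>2 + W2\<^sup>2) / 2)"
  define \<delta> where "\<delta> = sqrt ((\<delta>1\<^sup>2 + \<delta>2\<^sup>2) / 2)"
  have sq: "W\<^sup>2 = (W1\<^sup>2 + W2\<^sup>2) / 2" "\<delta>\<^sup>2 = (\<delta>1\<^sup>2 + \<delta>2\<^sup>2) / 2" and Wd: "W \<ge> 0" "\<delta> \<ge> 0"
    by (auto simp: W_def \<delta>_def)
  \<comment> \<open>The root mean square is at least the arithmetic mean; this controls the term -
    \<mu> * W of the elastic energy.\<close>
  have "((W1 + W2) / 2)\<^sup>2 \<le> W\<^sup>2"
    using sum_squares_bound[of W1 W2] unfolding sq by (simp add: power2_eq_square field_simps)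
  then have Wle: "(W1 + W2) / 2 \<le> W" using Wd(1) by (rule power2_le_imp_le)
  let ?x = "peierls_arg W \<delta>" and ?x1 = "peierls_arg W1 \<delta>1" and ?x2 = "peierls_arg W2 \<delta>2"
  have mid: "?x1 s + ?x2 s = 2 * ?x s" for s
    unfolding peierls_arg_def sq by (simp add: field_simps)
  have tangent: "peierls_h \<theta> (?x1 s) \<le> peierls_h \<theta> (?x s) + peierls_h' \<theta> (?x s) * (?x1 s - ?x s)"
    "peierls_h \<theta> (?x2 s) \<le> peierls_h \<theta> (?x s) + peierls_h' \<theta> (?x s) * (?x2 s - ?x s)"
    "?x1 s \<noteq> ?x s \<Longrightarrow> peierls_h \<theta> (?x1 s) < peierls_h \<theta> (?x s) + peierls_h' \<theta> (?x s) * (?x1 s - ?x s)" for s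
    using assms peierls_h_le_tangent peierls_h_less_tangent by auto
  have cancel: "peierls_h' \<theta> (?x s) * (?x1 s - ?x s) + peierls_h' \<theta> (?x s) * (?x2 s - ?x s) = 0" for s
    using mid[of s] by (simp add: distrib_left[symmetric])
  \<comment> \<open>The point s = 0 isolates W and s = pi / 2 isolates \<delta>, so one of the two
    witnesses strictness.\<close>
  have "W1\<^sup>2 \<noteq> W2\<^sup>2 \<or> \<delta>1\<^sup>2 \<noteq> \<delta>2\<^sup>2" using neq nonneg by auto
  then have "?x1 0 \<noteq> ?x 0 \<or> ?x1 (pi / 2) \<noteq> ?x (pi / 2)"
    by (auto simp: peierls_arg_def sq)
  moreover have "0 \<in> {0..2 * pi}" "pi / 2 \<in> {0..2 * pi}" by auto
  ultimately obtain s0 where s0: "s0 \<in> {0..2 * pi}" "?x1 s0 \<noteq> ?x s0" by blast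
  have "circ_mean (\<lambda>s. peierls_h \<theta> (?x1 s) + peierls_h \<theta> (?x2 s)) < circ_mean (\<lambda>s. 2 * peierls_h \<theta> (?x s))"
  proof (rule circ_mean_strict_mono[OF _ _ _ s0(1)])
    show "peierls_h \<theta> (?x1 s) + peierls_h \<theta> (?x2 s) \<le> 2 * peierls_h \<theta> (?x s)" for s
      using tangent(1,2)[of s] cancel[of s] by linarith
    show "peierls_h \<theta> (?x1 s0) + peierls_h \<theta> (?x2 s0) < 2 * peierls_h \<theta> (?x s0)"
      using tangent(2,3)[of s0] s0 cancel[of s0] by linarith
  qed (auto intro!: continuous_intros)
  then have "circ_mean (\<lambda>s. peierls_h \<theta> (?x1 s)) + circ_mean (\<lambda>s. peierls_h \<theta> (?x2 s))
      < 2 * circ_mean (\<lambda>s. peierls_h \<theta> (?x s))"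
    by (subst (asm) circ_mean_add) (auto intro!: continuous_intros simp: circ_mean_cmult)
  moreover have "2 * (\<mu> / 2 * ((W - 1)\<^sup>2 + \<delta>\<^sup>2)) \<le>
      \<mu> / 2 * ((W1 - 1)\<^sup>2 + \<delta>1\<^sup>2) + \<mu> / 2 * ((W2 - 1)\<^sup>2 + \<delta>2\<^sup>2)"
  proof -
    have "2 * ((W - 1)\<^sup>2 + \<delta>\<^sup>2) \<le> ((W1 - 1)\<^sup>2 + \<delta>1\<^sup>2) + ((W2 - 1)\<^sup>2 + \<delta>2\<^sup>2)"
      using Wle sq by (simp add: power2_diff)
    moreover have "2 * (\<mu> / 2 * a) \<le> \<mu> / 2 * b + \<mu> / 2 * c" if "2 * a \<le> b + c" for a b c
      using mult_left_mono[OF that, of "\<mu> / 2"] assms(1) by (simp add: distrib_left)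
    ultimately show ?thesis by blast
  qed
  moreover have "peierls_g \<mu> \<theta> W1 \<delta>1 \<le> peierls_g \<mu> \<theta> W \<delta>" "peierls_g \<mu> \<theta> W2 \<delta>2 \<le> peierls_g \<mu> \<theta> W \<delta>"
    using 1 2 Wd by (auto simp: is_peierls_minimizer_iff)
  ultimately show False unfolding peierls_g_eq by linarith
qed

subsection \<open>Criticality of the undimerized state\<close>

text \<open>For a stationary point \<open>(W, 0)\<close> put \<open>T = \<theta> / W\<close>. Stationarity in \<open>W\<close> reads
  \<open>W = 1 + 2 / \<mu> * dimer_A T\<close>, and the derivative in \<open>\<delta>\<^sup>2\<close> is
  \<open>(\<mu> / 2 - dimer_J T) / W\<close>.\<close>

definition dimer_A :: "real \<Rightarrow> real" where
  "dimer_A T = circ_mean (\<lambda>s. cos s * tanh (cos s / T))"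

text \<open>Up to the factor 1 / W, the derivative of the mean of \<open>peierls_h\<close> in the
  square of \<delta> at \<delta> = 0.\<close>

definition dimer_S :: "real \<Rightarrow> real" where
  "dimer_S T = circ_mean (\<lambda>s. (sin s)\<^sup>2 * tanhc (cos s / T)) / T"

definition dimer_J :: "real \<Rightarrow> real" where
  "dimer_J T = dimer_S T - dimer_A T"

text \<open>Stationarity eliminates W from \<theta> = T * W, which makes \<theta> a function of T
  alone.\<close>

definition dimer_temp :: "real \<Rightarrow> real \<Rightarrow> real" where
  "dimer_temp \<mu> T = T * (1 + 2 / \<mu> * dimer_A T)"

lemma continuous_on_divide_const [continuous_intros]:
  fixes f :: "'a::topological_space \<Rightarrow> real"
  assumes "continuous_on S f" shows "continuous_on S (\<lambda>x. f x / c)"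
  unfolding divide_inverse by (intro continuous_intros assms)

lemma x_tanh_x_div:
  assumes "T > (0::real)"
  shows "T * (x * tanh (x / T)) = x\<^sup>2 * tanhc (x / T)"
  using assms by (simp add: tanhc_def power2_eq_square)

text \<open>By evenness x may be replaced by its modulus. The last bound says that x * tanh (x / T)
  approaches \<bar>x\<bar> uniformly, with error at most T.\<close>

lemma x_tanh_x_bounds:
  fixes T x :: real
  assumes "T > 0"
  shows "0 \<le> x * tanh (x / T)" "x * tanh (x / T) \<le> \<bar>x\<bar>" "\<bar>x\<bar> - T \<le> x * tanh (x / T)"
proof -
  have eq: "x * tanh (x / T) = \<bar>x\<bar> * tanh (\<bar>x\<bar> / T)" by (simp add: abs_if)
  show "0 \<le> x * tanh (x / T)" unfolding eq using assms by simp
  show "x * tanh (x / T) \<le> \<bar>x\<bar>" unfolding eq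
    by (rule mult_left_le) (use tanh_real_lt_1[of "\<bar>x\<bar> / T"] in auto)
  have "\<bar>x\<bar> / T * (1 - tanh (\<bar>x\<bar> / T)) \<le> 1"
    by (rule mult_one_minus_tanh_le_1) (use assms in auto)
  then have "\<bar>x\<bar> * (1 - tanh (\<bar>x\<bar> / T)) \<le> T" using assms by (simp add: field_simps)
  then show "\<bar>x\<bar> - T \<le> x * tanh (x / T)" unfolding eq by (simp add: algebra_simps)
qed

lemma peierls_h'_arg:
  assumes "T > 0" "W > 0" "\<theta> = T * W"
  shows "peierls_h' \<theta> (peierls_arg W 0 s) = tanhc (cos s / T) / (4 * \<theta>)"
proof -
  have "sqrt (peierls_arg W 0 s) = 2 * (W * \<bar>cos s\<bar>)"
    using assms by (simp add: peierls_arg_def real_sqrt_mult)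
  then have "peierls_h' \<theta> (peierls_arg W 0 s) = tanhc (\<bar>cos s / T\<bar>) / (4 * \<theta>)"
    using assms by (simp add: peierls_h'_def)
  then show ?thesis unfolding tanhc_abs .
qed

text \<open>Integrating the tangent inequality of \<open>peierls_h\<close> at (W0, 0) bounds the
  electronic term by an expression linear in the squares of W and \<delta>. The bound is global, so
  conditions at one point decide minimality.\<close>

lemma peierls_g_ge_tangent:
  assumes "\<mu> > 0" "T > 0" "W0 > 0" "\<theta> = T * W0" "W0 = 1 + 2 / \<mu> * dimer_A T" "W \<ge> 0" "\<delta> \<ge> 0"
  shows "peierls_g \<mu> \<theta> W \<delta> \<ge>
    peierls_g \<mu> \<theta> W0 0 + \<mu> / 2 * ((W - W0)\<^sup>2 / W0) + \<delta>\<^sup>2 / W0 * (\<mu> / 2 - dimer_J T)"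
proof -
  let ?y = "peierls_arg W0 0" and ?x = "peierls_arg W \<delta>"
  let ?a = "\<lambda>s. cos s * tanh (cos s / T)" and ?b = "\<lambda>s. (sin s)\<^sup>2 * tanhc (cos s / T)"
  have \<theta>: "\<theta> > 0" using assms by simp
  \<comment> \<open>The increment of the argument splits: after averaging, the cos part yields
    \<open>dimer_A\<close> and the sin part \<open>dimer_S\<close>.\<close>
  have lin: "peierls_h' \<theta> (?y s) * (?x s - ?y s) = (W\<^sup>2 - W0\<^sup>2) / W0 * ?a s + \<delta>\<^sup>2 / \<theta> * ?b s" for s
  proof -
    have "peierls_h' \<theta> (?y s) * (?x s - ?y s)
        = ((W\<^sup>2 - W0\<^sup>2) * ((cos s)\<^sup>2 * tanhc (cos s / T)) + \<delta>\<^sup>2 * ?b s) / \<theta>"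
    proof -
      have "?x s - ?y s = 4 * ((W\<^sup>2 - W0\<^sup>2) * (cos s)\<^sup>2 + \<delta>\<^sup>2 * (sin s)\<^sup>2)"
        by (simp add: peierls_arg_def algebra_simps)
      moreover have "t / (4 * \<theta>) * (4 * (a * b + c * d)) = (a * (b * t) + c * (d * t)) / \<theta>" for t a b c d
        using \<theta> by (simp add: field_simps)
      ultimately show ?thesis unfolding peierls_h'_arg[OF assms(2,3,4)] by (simp only:)
    qed
    then show ?thesis
      unfolding x_tanh_x_div[OF assms(2), symmetric] using assms(2-4) by (simp add: field_simps)
  qed
  have "circ_mean (\<lambda>s. peierls_h \<theta> (?x s)) \<le>
      circ_mean (\<lambda>s. peierls_h \<theta> (?y s) + ((W\<^sup>2 - W0\<^sup>2) / W0 * ?a s + \<delta>\<^sup>2 / \<theta> * ?b s))"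
    by (rule circ_mean_mono)
      (use peierls_h_le_tangent[OF \<theta>, of "?y s" "?x s" for s] lin in \<open>auto intro!: continuous_intros\<close>)
  also have "\<dots> = circ_mean (\<lambda>s. peierls_h \<theta> (?y s)) + ((W\<^sup>2 - W0\<^sup>2) / W0 * dimer_A T
      + \<delta>\<^sup>2 / W0 * dimer_S T)"
    unfolding dimer_A_def dimer_S_def using assms(2,4)
    by (subst circ_mean_add circ_mean_cmult; (intro continuous_intros; simp)?)+ simp
  finally have "peierls_g \<mu> \<theta> W \<delta> \<ge> \<mu> / 2 * ((W - 1)\<^sup>2 + \<delta>\<^sup>2) - circ_mean (\<lambda>s. peierls_h \<theta> (?y s))
      - (W\<^sup>2 - W0\<^sup>2) / W0 * dimer_A T - \<delta>\<^sup>2 / W0 * (dimer_J T + dimer_A T)"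
    by (simp add: peierls_g_eq dimer_J_def)
  \<comment> \<open>Stationarity eliminates \<open>dimer_A\<close>; the remaining terms in W
    complete to \<open>(W - W0)\<^sup>2 / W0\<close>.\<close>
  moreover have "dimer_A T = \<mu> / 2 * (W0 - 1)" using assms(1,5) by simp
  moreover have "\<mu> / 2 * ((W - 1)\<^sup>2 + \<delta>\<^sup>2) - (W\<^sup>2 - W0\<^sup>2) / W0 * (\<mu> / 2 * (W0 - 1))
      - \<delta>\<^sup>2 / W0 * (dimer_J T + \<mu> / 2 * (W0 - 1)) = 
    \<mu> / 2 * (W0 - 1)\<^sup>2 + \<mu> / 2 * ((W - W0)\<^sup>2 / W0) + \<delta>\<^sup>2 / W0 * (\<mu> / 2 - dimer_J T)"
    using assms(3) by (simp add: field_simps power2_eq_square)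
  ultimately show ?thesis by (simp add: peierls_g_eq)
qed

lemma peierls_minimizer_undimerized:
  assumes "\<mu> > 0" "T > 0" "W0 > 0" "\<theta> = T * W0" "W0 = 1 + 2 / \<mu> * dimer_A T"
    and J: "dimer_J T \<le> \<mu> / 2"
  shows "is_peierls_minimizer \<mu> \<theta> (W0, 0)"
  unfolding is_peierls_minimizer_iff
proof safe
  fix W \<delta> :: real assume "W \<ge> 0" "\<delta> \<ge> 0"
  moreover have "0 \<le> \<mu> / 2 * ((W - W0)\<^sup>2 / W0)" "0 \<le> \<delta>\<^sup>2 / W0 * (\<mu> / 2 - dimer_J T)"
    using assms by simp_all
  ultimately show "peierls_g \<mu> \<theta> W0 0 \<le> peierls_g \<mu> \<theta> W \<delta>"
    using peierls_g_ge_tangent[OF assms(1-5), of W \<delta>] by linarith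
qed (use assms in auto)

text \<open>Here the tangent is taken at the dimerized state and evaluated at \<delta> = 0. It
  bounds the electronic gain below by \<open>\<delta>\<^sup>2 * R \<delta>\<close>, against the
  elastic cost \<open>\<mu> / 2 * \<delta>\<^sup>2\<close>; continuity of \<open>R\<close> at 0 then
  gives a suitable \<delta>.\<close>

lemma peierls_g_dimerization_gain:
  assumes "\<mu> > 0" "T > 0" "W0 > 0" "\<theta> = T * W0" "W0 = 1 + 2 / \<mu> * dimer_A T"
    and J: "dimer_J T > \<mu> / 2"
  shows "\<exists>\<delta>>0. peierls_g \<mu> \<theta> W0 \<delta> < peierls_g \<mu> \<theta> W0 0"
proof -
  have \<theta>: "\<theta> > 0" using assms by simp
  let ?x = "\<lambda>\<delta> s. peierls_arg W0 \<delta> s"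
  define R where "R = (\<lambda>\<delta>. circ_mean (\<lambda>s. 4 * (sin s)\<^sup>2 * peierls_h' \<theta> (?x \<delta> s)))"
  have "continuous_on UNIV R"
    unfolding R_def
    by (intro continuous_intros continuous_on_circ_mean) (auto simp: case_prod_unfold intro!: continuous_intros)
  then have "(R \<longlongrightarrow> R 0) (at_right 0)"
    by (simp add: continuous_on_eq_continuous_at isCont_def filterlim_at_split)
  moreover have "R 0 = dimer_S T / W0"
    unfolding R_def peierls_h'_arg[OF assms(2-4)] dimer_S_def using assms(2-4)
    by (simp add: circ_mean_def)
  \<comment> \<open>This is the hypothesis on \<open>dimer_J\<close>, because stationarity makes
    \<open>\<mu> / 2 + dimer_A T\<close> equal to \<open>\<mu> / 2 * W0\<close>.\<close>
  moreover have "dimer_S T / W0 > \<mu> / 2"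
  proof -
    have "dimer_S T > \<mu> / 2 + dimer_A T" using J by (simp add: dimer_J_def)
    also have "\<mu> / 2 + dimer_A T = \<mu> / 2 * W0" using assms(1,5) by (simp add: field_simps)
    finally show ?thesis using assms(3) by (simp add: field_simps)
  qed
  ultimately have "eventually (\<lambda>\<delta>. R \<delta> > \<mu> / 2) (at_right 0)"
    by (intro order_tendstoD(1)) auto
  then have "eventually (\<lambda>\<delta>. R \<delta> > \<mu> / 2 \<and> \<delta> > 0) (at_right 0)"
    by (intro eventually_conj eventually_at_right_less)
  then obtain \<delta> where \<delta>: "R \<delta> > \<mu> / 2" "\<delta> > 0"
    by (metis (mono_tags, lifting) eventually_happens trivial_limit_at_right_real)
  have "circ_mean (\<lambda>s. peierls_h \<theta> (?x 0 s) + \<delta>\<^sup>2 * (4 * (sin s)\<^sup>2 * peierls_h' \<theta> (?x \<delta> s)))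
    \<le> circ_mean (\<lambda>s. peierls_h \<theta> (?x \<delta> s))"
  proof (rule circ_mean_mono)
    fix s
    have "?x 0 s - ?x \<delta> s = - (4 * \<delta>\<^sup>2 * (sin s)\<^sup>2)" by (simp add: peierls_arg_def)
    then show "peierls_h \<theta> (?x 0 s) + \<delta>\<^sup>2 * (4 * (sin s)\<^sup>2 * peierls_h' \<theta> (?x \<delta> s)) \<le> peierls_h \<theta> (?x \<delta> s)"
      using peierls_h_le_tangent[OF \<theta>, of "?x \<delta> s" "?x 0 s"]
      by (simp only: peierls_arg_nonneg simp_thms) (simp add: algebra_simps)
  qed (auto intro!: continuous_intros)
  moreover have "circ_mean (\<lambda>s. peierls_h \<theta> (?x 0 s) + \<delta>\<^sup>2 * (4 * (sin s)\<^sup>2 * peierls_h' \<theta> (?x \<delta> s)))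
    = circ_mean (\<lambda>s. peierls_h \<theta> (?x 0 s)) + \<delta>\<^sup>2 * R \<delta>"
    unfolding R_def
    by (subst circ_mean_add) (auto intro!: continuous_intros simp: circ_mean_cmult)
  moreover have "\<delta>\<^sup>2 * (\<mu> / 2) < \<delta>\<^sup>2 * R \<delta>" using \<delta> by simp
  ultimately have "peierls_g \<mu> \<theta> W0 \<delta> < peierls_g \<mu> \<theta> W0 0"
    by (simp add: peierls_g_eq algebra_simps)
  then show ?thesis using \<delta> by blast
qed

text \<open>If \<delta> were 0, the tangent bound would make (W0, 0) at least as good as (W, 0), yet
  (W0, 0) can be improved strictly.\<close>

lemma peierls_minimizer_dimerized:
  assumes "\<mu> > 0" "T > 0" "W0 > 0" "\<theta> = T * W0" "W0 = 1 + 2 / \<mu> * dimer_A T"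
    and J: "dimer_J T > \<mu> / 2" and min: "is_peierls_minimizer \<mu> \<theta> (W, \<delta>)"
  shows "\<delta> > 0"
proof (rule ccontr)
  assume "\<not> \<delta> > 0"
  then have min0: "is_peierls_minimizer \<mu> \<theta> (W, 0)" and W: "W \<ge> 0"
    using min by (auto simp: is_peierls_minimizer_iff)
  obtain \<delta>' where \<delta>': "\<delta>' > 0" "peierls_g \<mu> \<theta> W0 \<delta>' < peierls_g \<mu> \<theta> W0 0"
    using peierls_g_dimerization_gain[OF assms(1-6)] by blast
  have "peierls_g \<mu> \<theta> W0 0 \<le> peierls_g \<mu> \<theta> W 0"
  proof -
    have "0 \<le> \<mu> / 2 * ((W - W0)\<^sup>2 / W0)" using assms(1,3) by simp
    then show ?thesis using peierls_g_ge_tangent[OF assms(1-5) W, of 0] by simp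
  qed
  also have "\<dots> \<le> peierls_g \<mu> \<theta> W0 \<delta>'"
    using min0 \<delta>' assms by (auto simp: is_peierls_minimizer_iff)
  finally show False using \<delta>' by simp
qed

section \<open>The correspondence between T and the temperature\<close>

lemma dimer_A_bounds:
  assumes "T > 0"
  shows "0 \<le> dimer_A T" "dimer_A T \<le> 1"
    "dimer_A T \<le> circ_mean (\<lambda>s. \<bar>cos s\<bar>)" "circ_mean (\<lambda>s. \<bar>cos s\<bar>) - T \<le> dimer_A T"
proof -
  have "circ_mean (\<lambda>s. 0) \<le> dimer_A T" "dimer_A T \<le> circ_mean (\<lambda>s. \<bar>cos s\<bar>)"
    "circ_mean (\<lambda>s. \<bar>cos s\<bar>) \<le> circ_mean (\<lambda>s. 1)"
    unfolding dimer_A_def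
    using x_tanh_x_bounds[OF assms] by (intro circ_mean_mono; force intro!: continuous_intros)+
  then show "0 \<le> dimer_A T" "dimer_A T \<le> 1" "dimer_A T \<le> circ_mean (\<lambda>s. \<bar>cos s\<bar>)" by auto
  have "circ_mean (\<lambda>s. \<bar>cos s\<bar> - T) \<le> dimer_A T"
    unfolding dimer_A_def
    using x_tanh_x_bounds[OF assms] by (intro circ_mean_mono) (auto intro!: continuous_intros)
  then show "circ_mean (\<lambda>s. \<bar>cos s\<bar>) - T \<le> dimer_A T"
    by (subst (asm) circ_mean_diff) (auto intro!: continuous_intros)
qed

lemma continuous_on_dimer_A: "continuous_on {0<..} dimer_A"
  unfolding dimer_A_def
  by (intro continuous_on_circ_mean) (auto simp: case_prod_unfold intro!: continuous_intros)

lemma continuous_on_dimer_J: "continuous_on {0<..} dimer_J"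
  unfolding dimer_J_def dimer_S_def
  by (intro continuous_intros continuous_on_circ_mean continuous_on_dimer_A)
    (auto simp: case_prod_unfold intro!: continuous_intros)

text \<open>The product \<open>T * dimer_A T\<close> is the mean of
  \<open>(cos s)\<^sup>2 * tanhc (cos s / T)\<close>. As \<open>tanhc\<close> decreases in the
  modulus of its argument, this mean does not decrease with T.\<close>

lemma dimer_temp_less:
  assumes "\<mu> > 0" "0 < T1" "T1 < T2"
  shows "dimer_temp \<mu> T1 < dimer_temp \<mu> T2"
proof -
  have eq: "T * dimer_A T = circ_mean (\<lambda>s. (cos s)\<^sup>2 * tanhc (cos s / T))" if "T > 0" for T
    unfolding dimer_A_def circ_mean_cmult[symmetric] x_tanh_x_div[OF that] ..
  have "T1 * dimer_A T1 \<le> T2 * dimer_A T2"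
    unfolding eq[OF assms(2)] eq[OF less_trans[OF assms(2,3)]]
  proof (rule circ_mean_mono)
    fix s
    have "tanhc \<bar>cos s / T1\<bar> \<le> tanhc \<bar>cos s / T2\<bar>"
      by (rule tanhc_le) (use assms in \<open>auto intro!: divide_left_mono\<close>)
    then have "tanhc (cos s / T1) \<le> tanhc (cos s / T2)" unfolding tanhc_abs .
    then show "(cos s)\<^sup>2 * tanhc (cos s / T1) \<le> (cos s)\<^sup>2 * tanhc (cos s / T2)"
      by (intro mult_left_mono) auto
  qed (auto intro!: continuous_intros)
  then have "2 / \<mu> * (T1 * dimer_A T1) \<le> 2 / \<mu> * (T2 * dimer_A T2)"
    using assms by (intro mult_left_mono) auto
  then show ?thesis using assms by (simp add: dimer_temp_def algebra_simps)
qed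

lemma dimer_temp_surj:
  assumes "\<mu> > 0" "\<theta> > 0"
  shows "\<exists>T>0. dimer_temp \<mu> T = \<theta>"
proof -
  \<comment> \<open>As \<open>dimer_A T\<close> lies in [0, 1], \<open>dimer_temp \<mu> T\<close>
    lies between T and T * b. The points \<theta> / b and \<theta> therefore bracket a
    solution.\<close>
  define b where "b = 1 + 2 / \<mu>"
  define a where "a = \<theta> / b"
  have b: "b > 1" using assms by (simp add: b_def)
  have a: "a > 0" "a \<le> \<theta>" "a * b = \<theta>"
    using assms b by (auto simp: a_def pos_divide_le_eq)
  have "2 / \<mu> * dimer_A a \<le> 2 / \<mu> * 1"
    using dimer_A_bounds[OF a(1)] assms by (intro mult_left_mono) auto
  then have "dimer_temp \<mu> a \<le> a * b"
    unfolding dimer_temp_def b_def using a by (intro mult_left_mono) auto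
  then have 1: "dimer_temp \<mu> a \<le> \<theta>" using a by simp
  have 2: "\<theta> \<le> dimer_temp \<mu> \<theta>"
    using dimer_A_bounds[OF assms(2)] assms by (simp add: dimer_temp_def algebra_simps)
  have "continuous_on {a..\<theta>} (dimer_temp \<mu>)"
    unfolding dimer_temp_def using a
    by (intro continuous_intros continuous_on_subset[OF continuous_on_dimer_A]) auto
  then obtain T where "a \<le> T" "T \<le> \<theta>" "dimer_temp \<mu> T = \<theta>"
    using IVT'[of "dimer_temp \<mu>" a \<theta> \<theta>] 1 2 a by blast
  then show ?thesis using a by (intro exI[of _ T]) auto
qed

subsection \<open>Monotonicity of the dimerization criterion\<close>

lemma circ_mean_sin2_minus_cos2: "circ_mean (\<lambda>s. (sin s)\<^sup>2 - (cos s)\<^sup>2) = 0"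
proof -
  have "((\<lambda>s. (sin s)\<^sup>2 - (cos s)\<^sup>2) has_integral
      - (sin (2 * pi) * cos (2 * pi)) - - (sin 0 * cos 0)) {0..2 * pi}"
    by (rule fundamental_theorem_of_calculus)
      (auto intro!: derivative_eq_intros
        simp: has_real_derivative_iff_has_vector_derivative[symmetric] power2_eq_square)
  then show ?thesis by (simp add: circ_mean_def integral_unique)
qed

text \<open>The weight has mean zero and the other factor depends only on \<bar>cos s\<bar>: the
  form needed for Chebyshev's inequality in \<open>dimer_J_less\<close>.\<close>

lemma dimer_J_eq:
  assumes "T > 0"
  shows "dimer_J T = circ_mean (\<lambda>s. ((sin s)\<^sup>2 - (cos s)\<^sup>2) * (tanhc (cos s / T) / T))"
proof -
  have "((sin s)\<^sup>2 - (cos s)\<^sup>2) * (tanhc (cos s / T) / T)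
      = inverse T * ((sin s)\<^sup>2 * tanhc (cos s / T)) - cos s * tanh (cos s / T)" for s
    using x_tanh_x_div[OF assms, of "cos s"] assms by (simp add: field_simps)
  then show ?thesis
    unfolding dimer_J_def dimer_S_def dimer_A_def
    by (simp only:) (subst circ_mean_diff;
      (auto intro!: continuous_intros simp: circ_mean_cmult divide_inverse)?)
qed

text \<open>The derivative of \<open>tanhc (z / T) / T\<close> in z is the numerator at z / T over
  \<open>z\<^sup>2\<close>, so T enters only through z / T. As z / T2 < z / T1, monotonicity of the
  numerator settles the sign.\<close>

lemma tanhc_scaled_diff_less:
  assumes "0 < T1" "T1 < T2" "0 \<le> u" "u < v"
  shows "tanhc (v / T1) / T1 - tanhc (v / T2) / T2 < tanhc (u / T1) / T1 - tanhc (u / T2) / T2"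
proof (rule DERIV_neg_imp_decreasing_open[OF assms(4)])
  let ?n = "\<lambda>x. x * (1 - (tanh x)\<^sup>2) - tanh x :: real"
  fix z assume z: "u < z" "z < v"
  have 1: "((\<lambda>z. tanhc (z / T) / T) has_real_derivative ?n (z / T) / z\<^sup>2) (at z)" if "T > 0" for T
  proof -
    have "(tanhc has_real_derivative ?n (z / T) / (z / T)\<^sup>2) (at (z / T))"
      by (rule has_real_derivative_tanhc) (use z assms that in auto)
    then have "((\<lambda>z. tanhc (z / T)) has_real_derivative ?n (z / T) / (z / T)\<^sup>2 * (1 / T)) (at z)"
      by (rule DERIV_chain2[where g = "\<lambda>z. z / T"])
        (use that in \<open>auto intro!: derivative_eq_intros\<close>)
    from DERIV_cdivide[OF this, of T] show ?thesis
      using that z assms by (simp add: power2_eq_square)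
  qed
  have "z / T2 < z / T1" using assms z by (intro divide_strict_left_mono) auto
  then have "?n (z / T1) < ?n (z / T2)"
    using assms z by (intro tanhc_deriv_numerator_less) auto
  then have "?n (z / T1) / z\<^sup>2 - ?n (z / T2) / z\<^sup>2 < 0"
    using z assms by (simp add: divide_strict_right_mono)
  then show "\<exists>d. ((\<lambda>z. tanhc (z / T1) / T1 - tanhc (z / T2) / T2) has_real_derivative d) (at z) \<and> d < 0"
    using DERIV_diff[OF 1 1, of T1 T2] assms by auto
qed (auto intro!: continuous_intros)

text \<open>Chebyshev's inequality: \<open>sin\<^sup>2 - cos\<^sup>2\<close> has mean zero and, like
  \<open>tanhc (\<cdot> / T1) / T1 - tanhc (\<cdot> / T2) / T2\<close>, decreases in \<open>\<bar>cos\<bar>\<close>.\<close>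

lemma dimer_J_less:
  assumes "0 < T1" "T1 < T2"
  shows "dimer_J T2 < dimer_J T1"
proof -
  define k where "k u = tanhc (u / T1) / T1 - tanhc (u / T2) / T2" for u
  \<comment> \<open>\<open>m\<close> is the value of \<bar>cos s\<bar> at which the weight changes
    sign. Subtracting \<open>k m\<close> leaves the mean unchanged, since the weight has mean zero,
    and makes the integrand nonnegative.\<close>
  define m :: real where "m = sqrt (1 / 2)"
  have k: "k v < k u" if "0 \<le> u" "u < v" for u v
    unfolding k_def using tanhc_scaled_diff_less[OF assms that] .
  have k_abs: "k \<bar>u\<bar> = k u" for u by (simp add: k_def abs_if)
  have cont: "continuous_on S (\<lambda>s. k (cos s))" for S
    unfolding k_def by (intro continuous_intros)
  let ?w = "\<lambda>s::real. (sin s)\<^sup>2 - (cos s)\<^sup>2"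
  have w: "?w s = 1 - 2 * (cos s)\<^sup>2" for s :: real
    using sin_cos_squared_add[of s] by simp
  have m: "0 \<le> m" "m < 1" "m\<^sup>2 = 1 / 2" by (auto simp: m_def)
  have "circ_mean (\<lambda>s. 0) < circ_mean (\<lambda>s. ?w s * (k (cos s) - k m))"
  proof (rule circ_mean_strict_mono[where s = 0])
    fix s :: real
    consider "\<bar>cos s\<bar> < m" | "\<bar>cos s\<bar> = m" | "\<bar>cos s\<bar> > m" by linarith
    then show "0 \<le> ?w s * (k (cos s) - k m)"
    proof cases
      case 1
      then have "\<bar>cos s\<bar>\<^sup>2 < m\<^sup>2" by (intro power_strict_mono) auto
      then have "?w s \<ge> 0" unfolding w using m by simp
      moreover have "k m < k (cos s)" using k[of "\<bar>cos s\<bar>" m] 1 k_abs by simp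
      ultimately show ?thesis by (intro mult_nonneg_nonneg) auto
    next
      case 2
      then show ?thesis using k_abs[of "cos s"] by simp
    next
      case 3
      then have "m\<^sup>2 < \<bar>cos s\<bar>\<^sup>2" using m by (intro power_strict_mono) auto
      then have "?w s \<le> 0" unfolding w using m by simp
      moreover have "k (cos s) < k m" using k[of m "\<bar>cos s\<bar>"] 3 m k_abs by simp
      ultimately show ?thesis by (intro mult_nonpos_nonpos) auto
    qed
  next
    show "0 < ?w 0 * (k (cos 0) - k m)" using k[of m 1] m by simp
  qed (auto intro!: continuous_intros cont)
  also have "\<dots> = circ_mean (\<lambda>s. ?w s * (tanhc (cos s / T1) / T1) - ?w s * (tanhc (cos s / T2) / T2) - k m * ?w s)"
    by (simp add: k_def algebra_simps)
  also have "\<dots> = dimer_J T1 - dimer_J T2 - k m * circ_mean ?w"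
    using assms dimer_J_eq
    by (subst circ_mean_diff, (auto intro!: continuous_intros)[2])
      (subst circ_mean_diff, (auto intro!: continuous_intros)[2], simp only: circ_mean_cmult)
  finally show ?thesis by (simp add: circ_mean_sin2_minus_cos2)
qed

text \<open>This crude decay gives the right endpoint in \<open>dimer_J_surj\<close> and later
  forces the critical T to 0.\<close>

lemma abs_dimer_J_le:
  assumes "T > 0"
  shows "\<bar>dimer_J T\<bar> \<le> 1 / T"
proof -
  have w: "\<bar>(sin s)\<^sup>2 - (cos s)\<^sup>2\<bar> \<le> 1" for s :: real
    using sin_cos_squared_add[of s] zero_le_power2[of "sin s"] zero_le_power2[of "cos s"]
    by linarith
  have ab: "\<bar>((sin s)\<^sup>2 - (cos s)\<^sup>2) * (tanhc (cos s / T) / T)\<bar> \<le> 1 * (1 / T)" for s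
    unfolding abs_mult
    using assms w tanhc_pos[of "cos s / T"] tanhc_le_1[of "cos s / T"]
    by (intro mult_mono) (auto intro!: divide_right_mono)
  have b: "- (1 / T) \<le> ((sin s)\<^sup>2 - (cos s)\<^sup>2) * (tanhc (cos s / T) / T)"
    "((sin s)\<^sup>2 - (cos s)\<^sup>2) * (tanhc (cos s / T) / T) \<le> 1 / T" for s
    using ab[of s] by linarith+
  have "circ_mean (\<lambda>s. - (1 / T)) \<le> dimer_J T" "dimer_J T \<le> circ_mean (\<lambda>s. 1 / T)"
    unfolding dimer_J_eq[OF assms] using b by (intro circ_mean_mono; auto intro!: continuous_intros)+
  then show ?thesis by simp
qed

subsection \<open>Logarithmic asymptotics of the integral of \<open>tanhc\<close>\<close>

lemma DERIV_integral_from_0: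
  fixes g :: "real \<Rightarrow> real"
  assumes "continuous_on UNIV g" "x > 0"
  shows "((\<lambda>x. integral {0..x} g) has_real_derivative g x) (at x)"
proof -
  have "((\<lambda>x. integral {0..x} g) has_real_derivative g x) (at x within {0..x + 1})"
    by (rule integral_has_real_derivative) (use assms in \<open>auto intro: continuous_on_subset\<close>)
  moreover have "x \<in> interior {0..x + 1}" using assms by simp
  ultimately show ?thesis using at_within_interior by metis
qed

lemma continuous_on_integral_from_0:
  fixes g :: "real \<Rightarrow> real"
  assumes "continuous_on UNIV g"
  shows "continuous_on {0..b} (\<lambda>x. integral {0..x} g)"
  by (intro indefinite_integral_continuous_1 integrable_continuous_real
      continuous_on_subset[OF assms]) auto

text \<open>The function is compared with the primitive of the exponential, which stays below 1 / a.
  The bound is uniform in X, so it survives X tending to infinity.\<close>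

lemma abs_le_of_DERIV_exp_bound:
  fixes f f' :: "real \<Rightarrow> real"
  assumes "a > 0" "X \<ge> 0" "f 0 = 0" "continuous_on {0..X} f"
    and D: "\<And>x. 0 < x \<Longrightarrow> (f has_real_derivative f' x) (at x)"
    and b: "\<And>x. 0 < x \<Longrightarrow> \<bar>f' x\<bar> \<le> exp (- a * x)"
  shows "\<bar>f X\<bar> \<le> 1 / a"
proof -
  define E where "E x = (1 - exp (- a * x)) / a" for x
  have DE: "(E has_real_derivative exp (- a * x)) (at x)" for x
    unfolding E_def using assms(1) by (auto intro!: derivative_eq_intros)
  have E: "E 0 = 0" "E X \<le> 1 / a" "continuous_on S E" for S
    unfolding E_def using assms(1,2) by (auto intro!: continuous_intros divide_right_mono)
  have "E 0 - f 0 \<le> E X - f X"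
  proof (rule DERIV_nonneg_imp_increasing_open[OF assms(2)])
    fix x assume "0 < x" "x < X"
    then show "\<exists>y. ((\<lambda>x. E x - f x) has_real_derivative y) (at x) \<and> 0 \<le> y"
      using DERIV_diff[OF DE D] b[of x] by (intro exI[of _ "exp (- a * x) - f' x"]) auto
  qed (intro continuous_intros E assms)
  moreover have "E 0 + f 0 \<le> E X + f X"
  proof (rule DERIV_nonneg_imp_increasing_open[OF assms(2)])
    fix x assume "0 < x" "x < X"
    then show "\<exists>y. ((\<lambda>x. E x + f x) has_real_derivative y) (at x) \<and> 0 \<le> y"
      using DERIV_add[OF DE D] b[of x] by (intro exI[of _ "exp (- a * x) + f' x"]) auto
  qed (intro continuous_intros E assms)
  ultimately show ?thesis using E assms(3) by simp
qed

text \<open>Exchange of limits by an \<epsilon> / 3 argument; the error bound holds eventually along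
  F, at a stage that may depend on n.\<close>

lemma tendsto_of_approximations:
  fixes f :: "'a \<Rightarrow> real" and g :: "nat \<Rightarrow> 'a \<Rightarrow> real"
  assumes g: "\<And>n. (g n \<longlongrightarrow> L n) F" and L: "L \<longlonglongrightarrow> l" and e: "e \<longlonglongrightarrow> 0"
    and fg: "\<And>n. eventually (\<lambda>x. \<bar>f x - g n x\<bar> \<le> e n) F"
  shows "(f \<longlongrightarrow> l) F"
proof (rule tendstoI)
  fix \<epsilon> :: real assume "\<epsilon> > 0"
  then have "\<epsilon> / 3 > 0" by simp
  then have "eventually (\<lambda>n. dist (L n) l < \<epsilon> / 3 \<and> dist (e n) 0 < \<epsilon> / 3) sequentially"
    using L e by (intro eventually_conj tendstoD)
  then obtain n where n: "dist (L n) l < \<epsilon> / 3" "dist (e n) 0 < \<epsilon> / 3"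
    using eventually_happens'[OF sequentially_bot] by blast
  show "eventually (\<lambda>x. dist (f x) l < \<epsilon>) F"
    using fg[of n] tendstoD[OF g[of n] \<open>\<epsilon> / 3 > 0\<close>]
    by eventually_elim (use n in \<open>unfold dist_real_def, linarith\<close>)
qed

section \<open>The exponential integral and Euler's constant\<close>

definition exp_quot :: "real \<Rightarrow> real" where
  "exp_quot v = (if v = 0 then 1 else (1 - exp (- v)) / v)"

text \<open>The complementary exponential integral: for X > 0 it equals ln X + \<gamma> + E1 X, and
  it is regular at 0.\<close>

definition Ein :: "real \<Rightarrow> real" where
  "Ein X = integral {0..X} exp_quot"

lemma isCont_exp_quot: "isCont exp_quot x"
proof (cases "x = 0")
  case True
  have "((\<lambda>v. 1 - exp (- v)) has_field_derivative 1) (at (0::real))"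
    by (auto intro!: derivative_eq_intros)
  then have "((\<lambda>h. (1 - exp (- h)) / h) \<longlongrightarrow> 1) (at (0::real))"
    by (simp add: DERIV_def)
  then have "(exp_quot \<longlongrightarrow> 1) (at 0)"
    by (rule Lim_transform_eventually) (auto simp: exp_quot_def eventually_at_filter)
  then show ?thesis
    using True by (simp add: isCont_def exp_quot_def)
next
  case False
  have "isCont (\<lambda>v. (1 - exp (- v)) / v) x"
    using False by (intro continuous_intros) auto
  moreover have "eventually (\<lambda>v. (1 - exp (- v)) / v = exp_quot v) (nhds x)"
    using t1_space_nhds[OF False] by eventually_elim (simp add: exp_quot_def)
  ultimately show ?thesis
    using isCont_cong[of "\<lambda>v. (1 - exp (- v)) / v" exp_quot x] by simp
qed

lemma continuous_on_exp_quot: "continuous_on S exp_quot"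
  by (simp add: continuous_at_imp_continuous_on isCont_exp_quot)

lemma exp_quot_pos: "exp_quot v > 0"
  by (auto simp: exp_quot_def zero_less_divide_iff)

lemma continuous_on_Ein_scaled:
  assumes "a \<ge> 0"
  shows "continuous_on {0..X} (\<lambda>x. Ein (a * x))"
  unfolding Ein_def
  by (rule continuous_on_compose2[OF continuous_on_integral_from_0[OF continuous_on_exp_quot, of "a * X"]])
    (use assms in \<open>auto intro!: continuous_intros mult_left_mono\<close>)

lemma DERIV_Ein_scaled:
  assumes "a \<ge> 0" "x > 0"
  shows "((\<lambda>x. Ein (a * x)) has_real_derivative (1 - exp (- a * x)) / x) (at x)"
proof (cases "a = 0")
  case False
  then have "(Ein has_real_derivative exp_quot (a * x)) (at (a * x))"
    unfolding Ein_def[abs_def] using assms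
    by (intro DERIV_integral_from_0 continuous_on_exp_quot) auto
  then have "((\<lambda>x. Ein (a * x)) has_real_derivative exp_quot (a * x) * a) (at x)"
    by (rule DERIV_chain2[where g = "\<lambda>x. a * x"]) (auto intro!: derivative_eq_intros)
  then show ?thesis using assms False by (simp add: exp_quot_def)
qed auto

lemma Ein_0 [simp]: "Ein 0 = 0"
  by (simp add: Ein_def)

lemma sum_exp_geometric:
  fixes x :: real
  assumes "x > 0"
  shows "(\<Sum>k=1..N. exp (- real k * x)) = (1 - exp (- real N * x)) / (exp x - 1)"
proof (induction N)
  case (Suc N)
  have "exp x > 1" using assms by simp
  moreover have "exp (- real N * x) = exp x * exp (- real (Suc N) * x)"
    by (simp add: exp_add[symmetric] algebra_simps)
  ultimately show ?case using Suc by (simp add: field_simps)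
qed simp

text \<open>From exp x \<ge> 1 + x and exp (- x) \<ge> 1 - x. This is the factor left over in the
  derivative of the error in \<open>Ein_harmonic_approx\<close>.\<close>

lemma inverse_minus_inverse_expm1_bounds:
  fixes x :: real
  assumes "x > 0"
  shows "0 \<le> 1 / x - 1 / (exp x - 1)" "1 / x - 1 / (exp x - 1) \<le> 1"
proof -
  have e: "exp x - 1 \<ge> x" using exp_ge_add_one_self[of x] by linarith
  then show "0 \<le> 1 / x - 1 / (exp x - 1)" using assms by (simp add: frac_le)
  have "1 - exp (- x) \<le> x" using exp_ge_add_one_self[of "- x"] by linarith
  then have "exp x * (1 - exp (- x)) \<le> exp x * x" by (intro mult_left_mono) auto
  then have "exp x - 1 \<le> x * exp x" by (simp add: algebra_simps exp_minus)
  then show "1 / x - 1 / (exp x - 1) \<le> 1" using e assms by (simp add: field_simps)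
qed

text \<open>Differentiation turns the sum into a geometric one. The term
  \<open>ln (exp_quot X)\<close> cancels the part of the derivative without N, and exp (- N * x)
  times a factor in [-1, 0] remains.\<close>

lemma Ein_harmonic_approx:
  assumes "X \<ge> 0" "N > 0"
  shows "\<bar>Ein (real N * X) - (\<Sum>k=1..N. (1 - exp (- real k * X)) / real k) + ln (exp_quot X)\<bar> \<le> 1 / real N"
proof (rule abs_le_of_DERIV_exp_bound[where f = "\<lambda>X. Ein (real N * X)
      - (\<Sum>k=1..N. (1 - exp (- real k * X)) / real k) + ln (exp_quot X)"
      and f' = "\<lambda>x. - exp (- real N * x) * (1 / x - 1 / (exp x - 1))"])
  show "continuous_on {0..X} (\<lambda>X. Ein (real N * X)
      - (\<Sum>k=1..N. (1 - exp (- real k * X)) / real k) + ln (exp_quot X))"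
    by (intro continuous_intros continuous_on_Ein_scaled continuous_on_exp_quot)
      (use exp_quot_pos in \<open>auto simp: less_imp_neq[symmetric]\<close>)
next
  fix x :: real assume x: "x > 0"
  have e: "exp x > 1" using x by simp
  have "((\<lambda>v. (1 - exp (- v)) / v) has_real_derivative (exp (- x) * x - (1 - exp (- x))) / x\<^sup>2) (at x)"
    using x by (auto intro!: derivative_eq_intros simp: power2_eq_square)
  then have "(exp_quot has_real_derivative (exp (- x) * x - (1 - exp (- x))) / x\<^sup>2) (at x)"
    by (rule DERIV_cong_ev[THEN iffD1, OF refl _ refl, rotated])
      (use t1_space_nhds[of x 0] x in \<open>auto simp: exp_quot_def elim!: eventually_mono\<close>)
  from DERIV_chain2[OF DERIV_ln_divide[OF exp_quot_pos] this]
  have "((\<lambda>x. ln (exp_quot x)) has_real_derivative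
      1 / exp_quot x * ((exp (- x) * x - (1 - exp (- x))) / x\<^sup>2)) (at x)" .
  also have "1 / exp_quot x * ((exp (- x) * x - (1 - exp (- x))) / x\<^sup>2) = 1 / (exp x - 1) - 1 / x"
    using x e by (simp add: exp_quot_def exp_minus field_simps power2_eq_square)
  finally have 1: "((\<lambda>x. ln (exp_quot x)) has_real_derivative 1 / (exp x - 1) - 1 / x) (at x)" .
  have 2: "((\<lambda>x. \<Sum>k=1..N. (1 - exp (- real k * x)) / real k) has_real_derivative
      (\<Sum>k=1..N. exp (- real k * x))) (at x)"
    by (rule DERIV_sum) (auto intro!: derivative_eq_intros)
  have "(1 - exp (- real N * x)) / x - (1 - exp (- real N * x)) / (exp x - 1) + (1 / (exp x - 1) - 1 / x)
      = - exp (- real N * x) * (1 / x - 1 / (exp x - 1))"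
    by (simp add: diff_divide_distrib algebra_simps)
  with DERIV_add[OF DERIV_diff[OF DERIV_Ein_scaled[of "real N", OF _ x] 2] 1]
  show "((\<lambda>X. Ein (real N * X) - (\<Sum>k=1..N. (1 - exp (- real k * X)) / real k) + ln (exp_quot X))
      has_real_derivative - exp (- real N * x) * (1 / x - 1 / (exp x - 1))) (at x)"
    unfolding sum_exp_geometric[OF x] by simp
  show "\<bar>- exp (- real N * x) * (1 / x - 1 / (exp x - 1))\<bar> \<le> exp (- real N * x)"
    using inverse_minus_inverse_expm1_bounds[OF x]
    unfolding abs_mult by (simp add: mult_left_le)
qed (use assms in \<open>auto simp: exp_quot_def\<close>)

text \<open>For fixed N write x = (N + 1) * X. As x grows, the sum tends to a harmonic number and
  \<open>ln (exp_quot X)\<close> behaves like - ln X, which leaves harm (N + 1) - ln (N + 1);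
  letting N grow gives \<gamma>.\<close>

lemma Ein_minus_ln_tendsto: "((\<lambda>x. Ein x - ln x) \<longlongrightarrow> euler_mascheroni) at_top"
proof (rule tendsto_of_approximations)
  let ?g = "\<lambda>N x. (\<Sum>k=1..Suc N. (1 - exp (- real k * (x / real (Suc N)))) / real k)
    - ln (1 - exp (- (x / real (Suc N)))) - ln (real (Suc N))"
  show "(?g N \<longlongrightarrow> harm (Suc N) - ln (real (Suc N))) at_top" for N
  proof -
    have lim: "((\<lambda>x. exp (- c * (x / real (Suc N)))) \<longlongrightarrow> 0) at_top" if "c > 0" for c :: real
      using that by real_asymp
    have "(?g N \<longlongrightarrow> (\<Sum>k=1..Suc N. (1 - 0) / real k) - ln (1 - 0) - ln (real (Suc N))) at_top"
      using lim[of 1] by (intro tendsto_intros lim) auto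
    then show ?thesis by (simp add: harm_def inverse_eq_divide)
  qed
  show "(\<lambda>N. harm (Suc N) - ln (real (Suc N))) \<longlonglongrightarrow> (euler_mascheroni :: real)"
    using LIMSEQ_Suc[OF euler_mascheroni_LIMSEQ] .
  show "(\<lambda>N. 1 / real (Suc N)) \<longlonglongrightarrow> 0" by real_asymp
  show "eventually (\<lambda>x. \<bar>(Ein x - ln x) - ?g N x\<bar> \<le> 1 / real (Suc N)) at_top" for N
    using eventually_gt_at_top[of 0]
  proof eventually_elim
    case (elim x)
    define X where "X = x / real (Suc N)"
    have X: "X > 0" "x = real (Suc N) * X" using elim by (auto simp: X_def)
    have "ln (exp_quot X) = ln (1 - exp (- X)) - ln X" "ln x = ln (real (Suc N)) + ln X"
      using X by (auto simp: exp_quot_def ln_div ln_mult)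
    then show ?case
      using Ein_harmonic_approx[of X "Suc N"] X unfolding X_def[symmetric] by simp
  qed
qed

lemma Ein_scaled_tendsto:
  assumes "a > 0"
  shows "((\<lambda>x. Ein (a * x) - ln x) \<longlongrightarrow> euler_mascheroni + ln a) at_top"
proof -
  have "filterlim (\<lambda>x. a * x) at_top at_top" using assms by real_asymp
  from tendsto_add[OF filterlim_compose[OF Ein_minus_ln_tendsto this] tendsto_const[of "ln a"]]
  show ?thesis
  proof (rule Lim_transform_eventually)
    show "\<forall>\<^sub>F x in at_top. Ein (a * x) - ln (a * x) + ln a = Ein (a * x) - ln x"
      using eventually_gt_at_top[of 0] by eventually_elim (use assms in \<open>simp add: ln_mult\<close>)
  qed
qed

section \<open>The integral of \<open>tanhc\<close> and Wallis' product\<close>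

definition tanhc_int :: "real \<Rightarrow> real" where
  "tanhc_int X = integral {0..X} tanhc"

text \<open>With q = exp (- 2 * v) the factor (1 - q) / (1 + q) is tanh v. Second differences keep
  every term of the form 1 - q ^ n, whose quotient by v integrates to an \<open>Ein\<close> term;
  the remainder is exact.\<close>

lemma tanh_partial_sum:
  fixes q :: real
  assumes "q > 0"
  shows "(1 - q) + (\<Sum>j=1..M. (1 - q ^ (2 * j + 1)) - 2 * (1 - q ^ (2 * j)) + (1 - q ^ (2 * j - 1)))
    = (1 - q) / (1 + q) * (1 + q ^ (2 * M + 1))"
proof (induction M)
  case 0
  then show ?case using assms by simp
next
  case (Suc M)
  have "(1 - q) / (1 + q) * (1 + q ^ (2 * M + 1)) + ((1 - q ^ (2 * Suc M + 1)) - 2 * (1 - q ^ (2 * Suc M))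
      + (1 - q ^ (2 * Suc M - 1))) = (1 - q) / (1 + q) * (1 + q ^ (2 * Suc M + 1))"
    using assms by (simp add: divide_simps) (simp add: algebra_simps)
  then show ?case using Suc by simp
qed

text \<open>Termwise integral of the series
  \<open>tanh v = (1 - q) - (\<Sum>j\<ge>1. q ^ (2 * j - 1) * (1 - q)\<^sup>2)\<close>, \<open>q = exp (- 2 * v)\<close>, divided by \<open>v\<close>.
  The terms are paired so that the limit becomes Wallis' product.\<close>

definition tanhc_int_approx :: "nat \<Rightarrow> real \<Rightarrow> real" where
  "tanhc_int_approx M X = Ein (2 * X) + (\<Sum>j=1..M. Ein (2 * (2 * real j + 1) * X)
      - 2 * Ein (2 * (2 * real j) * X) + Ein (2 * (2 * real j - 1) * X))"

text \<open>By \<open>tanh_partial_sum\<close> the derivative of the error is -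
  \<open>tanhc x\<close> times an exponential, and \<open>tanhc\<close> is at most 1.\<close>

lemma tanhc_int_approx_error:
  assumes "X \<ge> 0"
  shows "\<bar>tanhc_int X - tanhc_int_approx M X\<bar> \<le> 1 / (2 * (2 * real M + 1))"
proof (rule abs_le_of_DERIV_exp_bound[where f = "\<lambda>X. tanhc_int X - tanhc_int_approx M X"
      and f' = "\<lambda>x. - tanhc x * exp (- (2 * (2 * real M + 1)) * x)"])
  have "continuous_on {0..X} tanhc_int"
    unfolding tanhc_int_def[abs_def]
    by (intro continuous_on_integral_from_0 continuous_on_tanhc continuous_on_id)
  then show "continuous_on {0..X} (\<lambda>X. tanhc_int X - tanhc_int_approx M X)"
    unfolding tanhc_int_approx_def
    by (intro continuous_intros continuous_on_Ein_scaled) auto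
next
  fix x :: real assume x: "x > 0"
  define q where "q = exp (- (2 * x))"
  have q: "q > 0" by (simp add: q_def)
  have qpow: "exp (- (2 * y) * x) = q ^ n" if "y = real n" for y n
    unfolding q_def that by (simp add: exp_of_nat_mult[symmetric] mult_ac)
  have 1: "(tanhc_int has_real_derivative tanhc x) (at x)"
    unfolding tanhc_int_def[abs_def]
    by (intro DERIV_integral_from_0 continuous_on_tanhc continuous_on_id x)
  have E: "((\<lambda>x. Ein (2 * y * x)) has_real_derivative (1 - q ^ n) / x) (at x)" if "y = real n" for y n
    using DERIV_Ein_scaled[of "2 * y" x] x that qpow[OF that] by simp
  have "((\<lambda>x. Ein (2 * 1 * x) + (\<Sum>j=1..M. Ein (2 * (2 * real j + 1) * x)
      - 2 * Ein (2 * (2 * real j) * x) + Ein (2 * (2 * real j - 1) * x))) has_real_derivative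
    (1 - q ^ 1) / x + (\<Sum>j=1..M. (1 - q ^ (2 * j + 1)) / x - 2 * ((1 - q ^ (2 * j)) / x) + (1 - q ^ (2 * j - 1)) / x))
    (at x)"
    by (intro DERIV_add DERIV_sum DERIV_diff DERIV_cmult E) (auto simp: of_nat_diff)
  also have "(1 - q ^ 1) / x + (\<Sum>j=1..M. (1 - q ^ (2 * j + 1)) / x - 2 * ((1 - q ^ (2 * j)) / x) + (1 - q ^ (2 * j - 1)) / x)
      = ((1 - q) + (\<Sum>j=1..M. (1 - q ^ (2 * j + 1)) - 2 * (1 - q ^ (2 * j)) + (1 - q ^ (2 * j - 1)))) / x"
    by (simp add: add_divide_distrib diff_divide_distrib sum_divide_distrib)
  also have "\<dots> = tanhc x * (1 + q ^ (2 * M + 1))"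
    unfolding tanh_partial_sum[OF q] using x
    by (simp add: tanhc_def tanh_real_altdef q_def)
  finally have 2: "(tanhc_int_approx M has_real_derivative tanhc x * (1 + q ^ (2 * M + 1))) (at x)"
    unfolding tanhc_int_approx_def[abs_def] by simp
  have q': "q ^ (2 * M + 1) = exp (- (2 * (2 * real M + 1)) * x)"
    by (rule qpow[symmetric]) simp
  show "((\<lambda>X. tanhc_int X - tanhc_int_approx M X) has_real_derivative
      - tanhc x * exp (- (2 * (2 * real M + 1)) * x)) (at x)"
    using DERIV_diff[OF 1 2] unfolding q' by (simp add: algebra_simps)
  show "\<bar>- tanhc x * exp (- (2 * (2 * real M + 1)) * x)\<bar> \<le> exp (- (2 * (2 * real M + 1)) * x)"
    using tanhc_pos[of x] tanhc_le_1[of x] by (simp add: abs_mult)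
qed (use assms in \<open>auto simp: tanhc_int_def tanhc_int_approx_def\<close>)

text \<open>For fixed M every triple has coefficients 1, -2, 1, so its ln X and \<gamma> cancel and
  one copy of each survives. The other logarithms form a partial Wallis product; M goes to infinity
  last.\<close>

lemma tanhc_int_minus_ln_tendsto:
  "((\<lambda>X. tanhc_int X - ln X) \<longlongrightarrow> euler_mascheroni + ln 2 - ln (pi / 2)) at_top"
proof (rule tendsto_of_approximations)
  let ?P = "\<lambda>M. \<Prod>k=1..M. (4 * (real k)\<^sup>2) / (4 * (real k)\<^sup>2 - 1)"
  let ?c = "\<lambda>a. euler_mascheroni + ln (a :: real)"
  show "((\<lambda>X. tanhc_int_approx M X - ln X) \<longlongrightarrow> euler_mascheroni + ln 2 - ln (?P M)) at_top" for M
  proof -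
    have "((\<lambda>X. (Ein (2 * X) - ln X) + (\<Sum>j=1..M. (Ein (2 * (2 * real j + 1) * X) - ln X)
        - 2 * (Ein (2 * (2 * real j) * X) - ln X) + (Ein (2 * (2 * real j - 1) * X) - ln X))) \<longlongrightarrow>
      ?c 2 + (\<Sum>j=1..M. ?c (2 * (2 * real j + 1)) - 2 * ?c (2 * (2 * real j)) + ?c (2 * (2 * real j - 1)))) at_top"
      by (intro tendsto_intros Ein_scaled_tendsto) auto
    also have "(\<lambda>X. (Ein (2 * X) - ln X) + (\<Sum>j=1..M. (Ein (2 * (2 * real j + 1) * X) - ln X)
        - 2 * (Ein (2 * (2 * real j) * X) - ln X) + (Ein (2 * (2 * real j - 1) * X) - ln X)))
      = (\<lambda>X. tanhc_int_approx M X - ln X)"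
      by (simp add: tanhc_int_approx_def algebra_simps)
    also have "(\<Sum>j=1..M. ?c (2 * (2 * real j + 1)) - 2 * ?c (2 * (2 * real j)) + ?c (2 * (2 * real j - 1)))
      = (\<Sum>j=1..M. - ln ((4 * (real j)\<^sup>2) / (4 * (real j)\<^sup>2 - 1)))"
    proof (rule sum.cong[OF refl])
      fix j assume "j \<in> {1..M}"
      then have j: "real j \<ge> 1" by simp
      have e: "4 * (real j)\<^sup>2 - 1 = (2 * real j + 1) * (2 * real j - 1)" "4 * (real j)\<^sup>2 = (2 * real j) * (2 * real j)"
        by (simp_all add: power2_eq_square algebra_simps)
      have "ln (a * a / (b * c)) = 2 * ln a - ln b - ln c" if "a > 0" "b > 0" "c > 0" for a b c :: real
        using that by (simp add: ln_div ln_mult)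
      note this[of "2 * real j" "2 * real j + 1" "2 * real j - 1"]
      then have "ln ((4 * (real j)\<^sup>2) / (4 * (real j)\<^sup>2 - 1))
          = 2 * ln (2 * real j) - ln (2 * real j + 1) - ln (2 * real j - 1)"
        unfolding e(1) unfolding e(2) using j by simp
      moreover have "ln (2 * a) = ln 2 + ln a" if "a > 0" for a :: real
        using that by (simp add: ln_mult)
      note this[of "2 * real j + 1"] this[of "2 * real j"] this[of "2 * real j - 1"]
      ultimately show "?c (2 * (2 * real j + 1)) - 2 * ?c (2 * (2 * real j)) + ?c (2 * (2 * real j - 1))
          = - ln ((4 * (real j)\<^sup>2) / (4 * (real j)\<^sup>2 - 1))"
        using j by simp
    qed
    also have "\<dots> = - ln (?P M)"
    proof -
      have nz: "(4 * (real j)\<^sup>2) / (4 * (real j)\<^sup>2 - 1) \<noteq> 0" if "j \<in> {1..M}" for j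
      proof -
        have "1 \<le> (real j)\<^sup>2" using that by simp
        then have "4 * (real j)\<^sup>2 > 0" "4 * (real j)\<^sup>2 - 1 > 0" by linarith+
        then show ?thesis by simp
      qed
      show ?thesis by (subst ln_prod[OF finite_atLeastAtMost nz]) (simp_all add: sum_negf)
    qed
    finally show ?thesis by simp
  qed
  show "(\<lambda>M. euler_mascheroni + ln 2 - ln (?P M)) \<longlonglongrightarrow> euler_mascheroni + ln 2 - ln (pi / 2)"
    by (intro tendsto_intros wallis) simp
  show "(\<lambda>M. 1 / (2 * (2 * real M + 1))) \<longlonglongrightarrow> 0" by real_asymp
  show "eventually (\<lambda>X. \<bar>(tanhc_int X - ln X) - (tanhc_int_approx M X - ln X)\<bar> \<le> 1 / (2 * (2 * real M + 1))) at_top" for M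
    using eventually_ge_at_top[of "0::real"] by eventually_elim (use tanhc_int_approx_error in simp)
qed

section \<open>Reduction to a quarter period and the limit of small T\<close>

lemma circ_mean_quarter:
  fixes F :: "real \<Rightarrow> real"
  assumes "continuous_on UNIV F" and even: "\<And>x. F (- x) = F x"
  shows "circ_mean (\<lambda>s. F (cos s)) = 2 / pi * integral {0..pi / 2} (\<lambda>s. F (sin s))"
proof -
  let ?I = "integral {0..pi / 2} (\<lambda>s. F (sin s))"
  have cont: "continuous_on S (\<lambda>s. F (g s))" if "continuous_on S g" for S :: "real set" and g
    by (rule continuous_on_compose2[OF assms(1) that]) auto
  have shift: "integral {a..a + pi / 2} (\<lambda>s. F (cos s)) = integral {0..pi / 2} (\<lambda>s. F (cos (s + a)))" for a
    using integral_shift[of 0 a "pi / 2" "\<lambda>s. F (cos s)"] cont[OF continuous_on_cos[OF continuous_on_id]]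
    by (simp add: o_def add.commute)
  have 0: "integral {0..pi / 2} (\<lambda>s. F (cos s)) = ?I"
  proof -
    have "integral {0..pi / 2} (\<lambda>s. F (cos s)) = integral {-(pi / 2)..-0} (\<lambda>s. F (cos (- s)))"
      using Henstock_Kurzweil_Integration.integral_reflect_real[where f = "\<lambda>s. F (cos s)" and a = 0 and b = "pi / 2"] by simp
    also have "\<dots> = integral {-(pi / 2)..-(pi / 2) + pi / 2} (\<lambda>s. F (cos s))" by simp
    also have "\<dots> = integral {0..pi / 2} (\<lambda>s. F (cos (s + - (pi / 2))))" by (rule shift)
    finally show ?thesis by (simp add: cos_diff)
  qed
  have 1: "integral {pi / 2..pi} (\<lambda>s. F (cos s)) = ?I"
    using shift[of "pi / 2"] by (simp add: cos_add even)
  have 2: "integral {pi..3 * pi / 2} (\<lambda>s. F (cos s)) = ?I"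
    using shift[of pi] 0 by (simp add: even)
  have 3: "integral {3 * pi / 2..2 * pi} (\<lambda>s. F (cos s)) = ?I"
  proof -
    have "cos (s + 3 * pi / 2) = sin s" for s
    proof -
      have "s + 3 * pi / 2 = (s + pi / 2) + pi" by simp
      then show ?thesis by (simp only: cos_periodic_pi) (simp add: cos_add)
    qed
    then show ?thesis using shift[of "3 * pi / 2"] by simp
  qed
  have i: "(\<lambda>s. F (cos s)) integrable_on S" if "S = {a..b}" for S and a b :: real
    unfolding that by (intro integrable_continuous_real cont continuous_intros)
  have combine: "integral {a..c} (\<lambda>s. F (cos s)) + integral {c..b} (\<lambda>s. F (cos s))
      = integral {a..b} (\<lambda>s. F (cos s))" if "a \<le> c" "c \<le> b" for a b c :: real
    by (rule Henstock_Kurzweil_Integration.integral_combine[OF that i[OF refl]])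
  have "integral {0..2 * pi} (\<lambda>s. F (cos s)) = 4 * ?I"
    using combine[of 0 "pi / 2" "2 * pi"] combine[of "pi / 2" pi "2 * pi"]
      combine[of pi "3 * pi / 2" "2 * pi"] 0 1 2 3 by simp
  then show ?thesis by (simp add: circ_mean_def)
qed

lemma circ_mean_abs_cos: "circ_mean (\<lambda>s. \<bar>cos s\<bar>) = 2 / pi"
proof -
  have "(sin has_integral (- cos (pi / 2) - - cos 0)) {0..pi / 2}"
    by (rule fundamental_theorem_of_calculus)
      (auto intro!: derivative_eq_intros simp: has_real_derivative_iff_has_vector_derivative[symmetric])
  then have "integral {0..pi / 2} sin = (1::real)" by (simp add: integral_unique)
  moreover have "integral {0..pi / 2} (\<lambda>s. \<bar>sin s\<bar>) = integral {0..pi / 2} (sin :: real \<Rightarrow> real)"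
    by (rule integral_cong) (auto simp: sin_ge_zero)
  moreover have "circ_mean (\<lambda>s. \<bar>cos s\<bar>) = 2 / pi * integral {0..pi / 2} (\<lambda>s. \<bar>sin s\<bar>)"
    by (rule circ_mean_quarter) (auto intro!: continuous_intros)
  ultimately show ?thesis by simp
qed

text \<open>Splitting \<open>1 / sin s = cos s / sin s + sin s / (1 + cos s)\<close> isolates the logarithmic
  singularity in a term that can be integrated exactly.\<close>

lemma integral_tanhc_sin_error:
  assumes "T > 0"
  shows "\<bar>integral {0..pi / 2} (\<lambda>s. tanhc (sin s / T) / T) - tanhc_int (1 / T) - ln 2\<bar> \<le> T * (pi / 2)"
proof -
  let ?t = "\<lambda>s::real. sin s / (1 + cos s)"
  have sc: "sin s \<ge> 0" "cos s \<ge> 0" if "s \<in> {0..pi / 2}" for s :: real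
    using that by (auto intro!: sin_ge_zero cos_ge_zero)
  have pos: "1 + cos s > 0" if "s \<in> {0..pi / 2}" for s :: real
    using sc[OF that] by simp
  have t_cont: "continuous_on {0..pi / 2} ?t"
    by (intro continuous_intros) (use pos in force)
  have split: "tanhc (sin s / T) / T = tanhc (sin s / T) * (cos s / T) + ?t s * tanh (sin s / T)"
    if "s \<in> {0..pi / 2}" for s
  proof -
    have "(1 - cos s) * (1 + cos s) = sin s * sin s"
      using sin_cos_squared_add[of s] by (simp add: power2_eq_square algebra_simps)
    then have "1 - cos s = ?t s * sin s" using pos[OF that] by (simp add: field_simps)
    moreover have "tanh (sin s / T) = sin s * tanhc (sin s / T) / T"
      using mult_tanhc[of "sin s / T"] by simp
    ultimately have "?t s * tanh (sin s / T) = (1 - cos s) * tanhc (sin s / T) / T"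
      by simp
    then show ?thesis using assms by (simp add: field_simps)
  qed
  \<comment> \<open>Substitution u = sin s / T. The interior form of the fundamental theorem fits
    because \<open>tanhc_int\<close> is differentiated only at positive arguments.\<close>
  have "((\<lambda>s. tanhc (sin s / T) * (cos s / T)) has_integral
      (tanhc_int (sin (pi / 2) / T) - tanhc_int (sin 0 / T))) {0..pi / 2}"
  proof (rule fundamental_theorem_of_calculus_interior)
    have "continuous_on {0..1 / T} tanhc_int"
      unfolding tanhc_int_def[abs_def]
      by (intro continuous_on_integral_from_0 continuous_on_tanhc continuous_on_id)
    then show "continuous_on {0..pi / 2} (\<lambda>s. tanhc_int (sin s / T))"
      by (rule continuous_on_compose2)
        (use assms sc in \<open>auto intro!: continuous_intros divide_right_mono\<close>)
  next
    fix s assume s: "s \<in> {0<..<pi / 2}"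
    then have "sin s / T > 0" using assms by (simp add: sin_gt_zero)
    then have "(tanhc_int has_real_derivative tanhc (sin s / T)) (at (sin s / T))"
      unfolding tanhc_int_def[abs_def]
      by (intro DERIV_integral_from_0 continuous_on_tanhc continuous_on_id)
    then have "((\<lambda>s. tanhc_int (sin s / T)) has_real_derivative tanhc (sin s / T) * (cos s / T)) (at s)"
      by (rule DERIV_chain2[where g = "\<lambda>s. sin s / T"])
        (use assms in \<open>auto intro!: derivative_eq_intros\<close>)
    then show "((\<lambda>s. tanhc_int (sin s / T)) has_vector_derivative tanhc (sin s / T) * (cos s / T)) (at s)"
      by (simp add: has_real_derivative_iff_has_vector_derivative)
  qed simp
  then have I1: "((\<lambda>s. tanhc (sin s / T) * (cos s / T)) has_integral tanhc_int (1 / T)) {0..pi / 2}"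
    by (simp add: tanhc_int_def)
  have "(?t has_integral (- ln (1 + cos (pi / 2)) - - ln (1 + cos 0))) {0..pi / 2}"
  proof (rule fundamental_theorem_of_calculus)
    fix s :: real assume "s \<in> {0..pi / 2}"
    then have "((\<lambda>s. - ln (1 + cos s)) has_real_derivative ?t s) (at s within {0..pi / 2})"
      using pos[of s] by (auto intro!: derivative_eq_intros simp: divide_simps)
    then show "((\<lambda>s. - ln (1 + cos s)) has_vector_derivative ?t s) (at s within {0..pi / 2})"
      by (simp add: has_real_derivative_iff_has_vector_derivative)
  qed simp
  then have It: "integral {0..pi / 2} ?t = ln 2" "?t integrable_on {0..pi / 2}"
    by (auto simp: integral_unique)
  have i2: "(\<lambda>s. ?t s * tanh (sin s / T)) integrable_on {0..pi / 2}"
    by (intro integrable_continuous_real continuous_on_mult t_cont continuous_on_tanh continuous_intros) auto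
  have "integral {0..pi / 2} (\<lambda>s. tanhc (sin s / T) / T)
      = integral {0..pi / 2} (\<lambda>s. tanhc (sin s / T) * (cos s / T) + ?t s * tanh (sin s / T))"
    by (rule integral_cong) (rule split)
  also have "\<dots> = tanhc_int (1 / T) + integral {0..pi / 2} (\<lambda>s. ?t s * tanh (sin s / T))"
    unfolding integral_add[OF has_integral_integrable[OF I1] i2] integral_unique[OF I1] ..
  finally have eq: "integral {0..pi / 2} (\<lambda>s. tanhc (sin s / T) / T)
      = tanhc_int (1 / T) + integral {0..pi / 2} (\<lambda>s. ?t s * tanh (sin s / T))" .
  have upper: "?t s * tanh (sin s / T) \<le> ?t s" if "s \<in> {0..pi / 2}" for s
    using sc[OF that] tanh_real_lt_1[of "sin s / T"] by (intro mult_left_le) auto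
  \<comment> \<open>Since cos s \<ge> 0, the factor \<open>?t s\<close> is at most sin s, so
    replacing tanh by 1 costs at most sin s * (1 - tanh (sin s / T)) \<le> T pointwise.\<close>
  have lower: "?t s - T \<le> ?t s * tanh (sin s / T)" if "s \<in> {0..pi / 2}" for s
  proof -
    have "sin s * (1 - tanh (sin s / T)) \<le> T"
      using x_tanh_x_bounds(3)[OF assms, of "sin s"] sc[OF that] by (simp add: algebra_simps)
    moreover have "?t s * (1 - tanh (sin s / T)) \<le> sin s * (1 - tanh (sin s / T))"
    proof (rule mult_right_mono)
      show "?t s \<le> sin s" using sc[OF that] by (simp add: pos_divide_le_eq distrib_left)
      show "0 \<le> 1 - tanh (sin s / T)" using tanh_real_lt_1[of "sin s / T"] by simp
    qed
    ultimately show ?thesis by (simp only: right_diff_distrib mult_1_right)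
  qed
  have "integral {0..pi / 2} (\<lambda>s. ?t s * tanh (sin s / T)) \<le> integral {0..pi / 2} ?t"
    by (intro integral_le i2 It upper)
  moreover have "integral {0..pi / 2} (\<lambda>s. ?t s - T) \<le> integral {0..pi / 2} (\<lambda>s. ?t s * tanh (sin s / T))"
    by (intro integral_le i2 integrable_diff It lower integrable_const_ivl)
  moreover have "integral {0..pi / 2} (\<lambda>s. ?t s - T) = ln 2 - T * (pi / 2)"
    using It by (subst integral_diff) auto
  ultimately show ?thesis using It assms unfolding eq by (auto simp: abs_le_iff)
qed

text \<open>Writing the weight as \<open>1 - 2 * (cos s)\<^sup>2\<close> separates the part that
  diverges as T tends to 0 from a bounded multiple of \<open>dimer_A\<close>.\<close>

lemma dimer_J_eq_integral:
  assumes "T > 0"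
  shows "dimer_J T = 2 / pi * integral {0..pi / 2} (\<lambda>s. tanhc (sin s / T) / T) - 2 * dimer_A T"
proof -
  have "((sin s)\<^sup>2 - (cos s)\<^sup>2) * (tanhc (cos s / T) / T)
      = tanhc (cos s / T) / T - 2 * (cos s * tanh (cos s / T))" for s
  proof -
    have "cos s * tanh (cos s / T) = (cos s)\<^sup>2 * tanhc (cos s / T) / T"
      using x_tanh_x_div[OF assms, of "cos s"] assms by (simp add: field_simps)
    then show ?thesis
      unfolding sin_squared_eq using assms by (simp add: field_simps)
  qed
  then have "dimer_J T = circ_mean (\<lambda>s. tanhc (cos s / T) / T - 2 * (cos s * tanh (cos s / T)))"
    unfolding dimer_J_eq[OF assms] by (simp only:)
  also have "\<dots> = circ_mean (\<lambda>s. tanhc (cos s / T) / T) - 2 * dimer_A T"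
    unfolding dimer_A_def circ_mean_cmult[symmetric]
    by (rule circ_mean_diff) (auto intro!: continuous_intros)
  also have "circ_mean (\<lambda>s. tanhc (cos s / T) / T) = 2 / pi * integral {0..pi / 2} (\<lambda>s. tanhc (sin s / T) / T)"
    by (rule circ_mean_quarter) (auto intro!: continuous_intros)
  finally show ?thesis .
qed

lemma dimer_A_tendsto: "(dimer_A \<longlongrightarrow> 2 / pi) (at_right 0)"
proof (rule tendsto_sandwich)
  show "eventually (\<lambda>T. 2 / pi - T \<le> dimer_A T) (at_right 0)" "eventually (\<lambda>T. dimer_A T \<le> 2 / pi) (at_right 0)"
    using eventually_at_right_less[of "0::real"]
    by (eventually_elim, use dimer_A_bounds(3,4) circ_mean_abs_cos in force)+
  have "((\<lambda>T. 2 / pi - T) \<longlongrightarrow> 2 / pi - 0) (at_right 0)" by (intro tendsto_intros)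
  then show "((\<lambda>T. 2 / pi - T) \<longlongrightarrow> 2 / pi) (at_right 0)" by simp
qed simp

text \<open>Inside the factor 2 / \<pi>, \<open>tanhc_int\<close> contributes \<gamma> + ln 2 - ln
  (\<pi> / 2), the half-angle term ln 2, and \<open>dimer_A\<close> the summand -2; the logarithms
  combine to ln (8 / \<pi>).\<close>

lemma dimer_J_asymptotics:
  "((\<lambda>T. dimer_J T + 2 / pi * ln T) \<longlongrightarrow> 2 / pi * (euler_mascheroni + ln (8 / pi) - 2)) (at_right 0)"
proof -
  let ?I = "\<lambda>T. integral {0..pi / 2} (\<lambda>s. tanhc (sin s / T) / T)"
  have err: "((\<lambda>T. ?I T - tanhc_int (1 / T) - ln 2) \<longlongrightarrow> 0) (at_right 0)"
  proof (rule Lim_null_comparison)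
    show "eventually (\<lambda>T. norm (?I T - tanhc_int (1 / T) - ln 2) \<le> T * (pi / 2)) (at_right 0)"
      using eventually_at_right_less[of "0::real"]
      by eventually_elim (simp only: real_norm_def integral_tanhc_sin_error)
    show "((\<lambda>T. T * (pi / 2)) \<longlongrightarrow> 0) (at_right 0)" by real_asymp
  qed
  have "filterlim (\<lambda>T::real. 1 / T) at_top (at_right 0)" by real_asymp
  from filterlim_compose[OF tanhc_int_minus_ln_tendsto this]
  have main: "((\<lambda>T. tanhc_int (1 / T) - ln (1 / T)) \<longlongrightarrow> euler_mascheroni + ln 2 - ln (pi / 2)) (at_right 0)" .
  have lim: "((\<lambda>T. 2 / pi * ((tanhc_int (1 / T) - ln (1 / T)) + (?I T - tanhc_int (1 / T) - ln 2) + ln 2) - 2 * dimer_A T)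
      \<longlongrightarrow> 2 / pi * ((euler_mascheroni + ln 2 - ln (pi / 2)) + 0 + ln 2) - 2 * (2 / pi)) (at_right 0)"
    by (intro tendsto_intros main err dimer_A_tendsto)
  have const: "2 / pi * ((euler_mascheroni + ln 2 - ln (pi / 2)) + 0 + ln 2) - 2 * (2 / pi)
      = 2 / pi * (euler_mascheroni + ln (8 / pi) - 2)"
  proof -
    have "ln (8 / pi) = ln (2 * (2 / (pi / 2)))" by simp
    also have "\<dots> = ln 2 + ln (2 / (pi / 2))" by (subst ln_mult) auto
    also have "ln (2 / (pi / 2)) = ln 2 - ln (pi / 2)" by (subst ln_div) auto
    finally show ?thesis by (simp add: right_diff_distrib)
  qed
  show ?thesis
  proof (rule Lim_transform_eventually[OF lim[unfolded const]])
    show "eventually (\<lambda>T. 2 / pi * ((tanhc_int (1 / T) - ln (1 / T)) + (?I T - tanhc_int (1 / T) - ln 2) + ln 2)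
        - 2 * dimer_A T = dimer_J T + 2 / pi * ln T) (at_right 0)"
      using eventually_at_right_less[of "0::real"]
      by eventually_elim (simp add: dimer_J_eq_integral ln_div algebra_simps)
  qed
qed

lemma dimer_J_at_top: "filterlim dimer_J at_top (at_right 0)"
proof -
  have "filterlim (\<lambda>T::real. - (2 / pi) * ln T) at_top (at_right 0)"
    by real_asymp
  from filterlim_tendsto_add_at_top[OF dimer_J_asymptotics this] show ?thesis by simp
qed

text \<open>Divergence at 0 gives a value of at least c, and the bound 1 / T gives a value of at
  most c at T = 1 / c.\<close>

lemma dimer_J_surj:
  assumes "c > 0"
  shows "\<exists>T>0. dimer_J T = c"
proof -
  have "eventually (\<lambda>T. dimer_J T \<ge> c \<and> T < 1 / c \<and> T > 0) (at_right 0)"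
    using dimer_J_at_top assms unfolding filterlim_at_top
    by (intro eventually_conj eventually_at_right_less order_tendstoD(2)[OF tendsto_ident_at]) auto
  then obtain a where a: "dimer_J a \<ge> c" "a < 1 / c" "a > 0"
    by (metis (mono_tags, lifting) eventually_happens trivial_limit_at_right_real)
  have "dimer_J (1 / c) \<le> c" using abs_dimer_J_le[of "1 / c"] assms by simp
  moreover have "continuous_on {a..1 / c} dimer_J"
    by (rule continuous_on_subset[OF continuous_on_dimer_J]) (use a in auto)
  ultimately obtain T where "a \<le> T" "dimer_J T = c"
    using IVT2'[of dimer_J "1 / c" c a] a by force
  then show ?thesis using a by (intro exI[of _ T]) auto
qed

subsection \<open>The critical temperature\<close>

definition peierls_const :: real where
  "peierls_const = exp (euler_mascheroni + ln (8 / pi) - 2)"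

text \<open>In the second bound the Maclaurin remainder is estimated by a multiple of exp x itself,
  which avoids a separate upper bound on exp x.\<close>

lemma exp_bounds_Taylor:
  fixes x :: real
  assumes "x \<ge> 0"
  shows "(\<Sum>m<n. x ^ m / fact m) \<le> exp x" "exp x * (1 - x ^ n / fact n) \<le> (\<Sum>m<n. x ^ m / fact m)"
proof -
  obtain t where t: "\<bar>t\<bar> \<le> \<bar>x\<bar>" "exp x = (\<Sum>m<n. x ^ m / fact m) + exp t / fact n * x ^ n"
    using Maclaurin_exp_le[of x n] by auto
  show "(\<Sum>m<n. x ^ m / fact m) \<le> exp x" using t(2) assms by simp
  have "exp t \<le> exp x" using t(1) assms by simp
  then have "exp t * (x ^ n / fact n) \<le> exp x * (x ^ n / fact n)"
    using assms by (intro mult_right_mono) auto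
  moreover have "exp x = (\<Sum>m<n. x ^ m / fact m) + exp t * (x ^ n / fact n)"
    using t(2) by simp
  ultimately show "exp x * (1 - x ^ n / fact n) \<le> (\<Sum>m<n. x ^ m / fact m)"
    unfolding right_diff_distrib by linarith
qed

lemma harm_127_bounds: "harm 127 \<in> {5.4253345<..<5.4253346 :: real}"
  by (simp add: harm_expand)

text \<open>The index 127 is chosen because 127 + 1 = 128 and 8 / \<pi> = 128 / (16 * \<pi>): the
  logarithm in the bounds for \<gamma> cancels, and the exponent is enclosed by rationals.\<close>

lemma peierls_const_bounds: "\<bar>peierls_const - 0.61385\<bar> < 5 / 10 ^ 5"
proof -
  have g: "harm 127 - ln 128 + 1 / 256 \<le> (euler_mascheroni :: real)"
    "euler_mascheroni \<le> harm 127 - ln 128 + (1 / 254 :: real)"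
    using euler_mascheroni_bounds[of 127] by (auto simp: inverse_eq_divide)
  have eq: "peierls_const = exp (euler_mascheroni + ln 128 - 2) / (16 * pi)"
    by (simp add: peierls_const_def exp_add exp_diff)
  \<comment> \<open>An eighth of the exponent is below 1 / 2, where nine Taylor terms are accurate
    enough; the result is raised to the eighth power.\<close>
  have pow8: "exp (8 * y) = exp y ^ 8" for y :: real
    using exp_of_nat_mult[of 8 y] by simp
  have "30.853 < (1.535191 :: real) ^ 8"
    by (simp add: power_divide)
  also have "\<dots> \<le> exp 0.428655 ^ 8"
  proof (rule power_mono)
    have "1.535191 \<le> (\<Sum>m<9. (0.428655 :: real) ^ m / fact m)"
      by (simp add: eval_nat_numeral fact_numeral)
    also have "\<dots> \<le> exp 0.428655" by (rule exp_bounds_Taylor) simp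
    finally show "1.535191 \<le> exp (0.428655 :: real)" .
  qed simp
  also have "\<dots> = exp (3.42924 :: real)" unfolding pow8[symmetric] by simp
  also have "\<dots> \<le> exp (euler_mascheroni + ln 128 - 2)"
    using g(1) harm_127_bounds by simp
  finally have 1: "30.853 < exp (euler_mascheroni + ln 128 - 2 :: real)" .
  have "exp (0.42866 :: real) \<le> 1.5352"
  proof -
    let ?x = "0.42866 :: real"
    have "?x ^ 9 / fact 9 \<le> 1 / 10 ^ 7" by (simp add: eval_nat_numeral fact_numeral)
    then have "exp ?x * (1 - 1 / 10 ^ 7) \<le> exp ?x * (1 - ?x ^ 9 / fact 9)"
      by (intro mult_left_mono diff_left_mono) auto
    also have "\<dots> \<le> (\<Sum>m<9. ?x ^ m / fact m)"
      by (rule exp_bounds_Taylor) simp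
    also have "\<dots> \<le> 1.535199"
      by (simp add: eval_nat_numeral fact_numeral)
    finally show ?thesis by simp
  qed
  have "exp (euler_mascheroni + ln 128 - 2) \<le> exp (3.42928 :: real)"
    using g(2) harm_127_bounds by simp
  also have "\<dots> = exp 0.42866 ^ 8" unfolding pow8[symmetric] by simp
  also have "\<dots> \<le> (1.5352 :: real) ^ 8"
    using \<open>exp (0.42866 :: real) \<le> 1.5352\<close> by (intro power_mono) auto
  also have "\<dots> < 30.857" by (simp add: power_divide)
  finally have 2: "exp (euler_mascheroni + ln 128 - 2 :: real) < 30.857" .
  have "0.6138 * (16 * pi) < 30.853" "30.857 < 0.6139 * (16 * pi)"
    using pi_approx by simp_all
  with 1 2 have "0.6138 < peierls_const" "peierls_const < 0.6139"
    unfolding eq by (simp_all add: pos_less_divide_eq pos_divide_less_eq)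
  then show ?thesis unfolding abs_less_iff by simp
qed

theorem theorem1p4:
  shows "\<exists>\<theta>\<^sub>c :: real \<Rightarrow> real.
    (\<forall>\<mu>>0. \<theta>\<^sub>c \<mu> > 0 \<and>
       (\<forall>\<theta>>0. \<exists>!p. is_peierls_minimizer \<mu> \<theta> p) \<and>
       (\<forall>\<theta>. \<theta> \<ge> \<theta>\<^sub>c \<mu> \<longrightarrow> (\<forall>W \<delta>. is_peierls_minimizer \<mu> \<theta> (W, \<delta>) \<longrightarrow> \<delta> = 0)) \<and>
       (\<forall>\<theta>. 0 < \<theta> \<and> \<theta> < \<theta>\<^sub>c \<mu> \<longrightarrow> (\<forall>W \<delta>. is_peierls_minimizer \<mu> \<theta> (W, \<delta>) \<longrightarrow> \<delta> > 0))) \<and>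
    (\<exists>C::real. \<bar>C - 0.61385\<bar> < 5 / 10 ^ 5 \<and>
       \<theta>\<^sub>c \<sim>[at_top] (\<lambda>\<mu>. C * exp (- (pi / 4) * \<mu>)))"
proof -
  \<comment> \<open>The critical T is where the one-sided derivative in the square of \<delta>
    vanishes.\<close>
  have "\<forall>\<mu>. \<exists>T. \<mu> > 0 \<longrightarrow> T > 0 \<and> dimer_J T = \<mu> / 2"
    using dimer_J_surj by (metis half_gt_zero)
  then obtain Tc where Tc: "Tc \<mu> > 0" "dimer_J (Tc \<mu>) = \<mu> / 2" if "\<mu> > 0" for \<mu>
    by metis
  define \<theta>c where "\<theta>c \<mu> = dimer_temp \<mu> (Tc \<mu>)" for \<mu>
  have temp_pos: "1 + 2 / \<mu> * dimer_A T > 0" if "\<mu> > 0" "T > 0" for \<mu> T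
    using dimer_A_bounds(1)[OF that(2)] that(1) by (simp add: add_pos_nonneg)
  have "\<theta>c \<mu> > 0 \<and>
       (\<forall>\<theta>>0. \<exists>!p. is_peierls_minimizer \<mu> \<theta> p) \<and>
       (\<forall>\<theta>. \<theta> \<ge> \<theta>c \<mu> \<longrightarrow> (\<forall>W \<delta>. is_peierls_minimizer \<mu> \<theta> (W, \<delta>) \<longrightarrow> \<delta> = 0)) \<and>
       (\<forall>\<theta>. 0 < \<theta> \<and> \<theta> < \<theta>c \<mu> \<longrightarrow> (\<forall>W \<delta>. is_peierls_minimizer \<mu> \<theta> (W, \<delta>) \<longrightarrow> \<delta> > 0))"
    if \<mu>: "\<mu> > 0" for \<mu>
  proof (intro conjI allI impI)
    show c: "\<theta>c \<mu> > 0"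
      unfolding \<theta>c_def dimer_temp_def using Tc[OF \<mu>] temp_pos[OF \<mu>] by simp
    show "\<exists>!p. is_peierls_minimizer \<mu> \<theta> p" if "\<theta> > 0" for \<theta>
      using peierls_minimizer_exists[OF \<mu> that] peierls_minimizer_unique[OF \<mu> that]
      by (metis surj_pair)
    fix \<theta> W \<delta> assume min: "is_peierls_minimizer \<mu> \<theta> (W, \<delta>)"
    show "\<delta> = 0" if "\<theta>c \<mu> \<le> \<theta>"
    proof -
      have \<theta>: "\<theta> > 0" using that c by simp
      obtain T where T: "T > 0" "dimer_temp \<mu> T = \<theta>" using dimer_temp_surj[OF \<mu> \<theta>] by blast
      \<comment> \<open>Since \<open>dimer_temp \<mu>\<close> strictly increases, comparing
        temperatures amounts to comparing values of T; \<open>dimer_J\<close> reverses the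
        order.\<close>
      have "Tc \<mu> \<le> T"
        using dimer_temp_less[OF \<mu> T(1), of "Tc \<mu>"] that T by (force simp: \<theta>c_def)
      then have "dimer_J T \<le> \<mu> / 2"
        using dimer_J_less[OF Tc(1)[OF \<mu>], of T] Tc(2)[OF \<mu>] by (cases "Tc \<mu> = T") auto
      then have "is_peierls_minimizer \<mu> \<theta> (1 + 2 / \<mu> * dimer_A T, 0)"
        using T temp_pos[OF \<mu> T(1)] \<mu> by (intro peierls_minimizer_undimerized) (auto simp: dimer_temp_def)
      then show ?thesis using peierls_minimizer_unique[OF \<mu> \<theta> min] by simp
    qed
    show "\<delta> > 0" if \<theta>: "0 < \<theta> \<and> \<theta> < \<theta>c \<mu>"
    proof -
      obtain T where T: "T > 0" "dimer_temp \<mu> T = \<theta>" using dimer_temp_surj[OF \<mu>] \<theta> by blast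
      have "T < Tc \<mu>"
        using dimer_temp_less[OF \<mu> Tc(1)[OF \<mu>], of T] \<theta> T
        by (cases T "Tc \<mu>" rule: linorder_cases) (auto simp: \<theta>c_def)
      then have "dimer_J T > \<mu> / 2"
        using dimer_J_less[OF T(1), of "Tc \<mu>"] Tc(2)[OF \<mu>] by simp
      then show ?thesis
        using T temp_pos[OF \<mu> T(1)] \<mu> min
        by (intro peierls_minimizer_dimerized[of \<mu> T "1 + 2 / \<mu> * dimer_A T" \<theta> W \<delta>]) (auto simp: dimer_temp_def)
    qed
  qed
  moreover have "\<theta>c \<sim>[at_top] (\<lambda>\<mu>. peierls_const * exp (- (pi / 4) * \<mu>))"
  proof (rule asymp_equivI')
    \<comment> \<open>The value \<open>\<mu> / 2\<close> of \<open>dimer_J\<close> at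
      \<open>Tc \<mu>\<close> is at most \<open>1 / Tc \<mu>\<close>, hence
      \<open>Tc \<mu> \<le> 2 / \<mu>\<close>.\<close>
    have "(Tc \<longlongrightarrow> 0) at_top"
    proof (rule tendsto_sandwich)
      show "eventually (\<lambda>\<mu>. 0 \<le> Tc \<mu>) at_top"
        using eventually_gt_at_top[of "0::real"] by eventually_elim (simp add: Tc(1) less_imp_le)
      show "eventually (\<lambda>\<mu>. Tc \<mu> \<le> 2 / \<mu>) at_top"
        using eventually_gt_at_top[of "0::real"]
      proof eventually_elim
        case (elim \<mu>)
        then show ?case
          using abs_dimer_J_le[OF Tc(1), of \<mu>] Tc by (simp add: field_simps)
      qed
      show "((\<lambda>\<mu>::real. 2 / \<mu>) \<longlongrightarrow> 0) at_top" by real_asymp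
    qed simp
    moreover have "eventually (\<lambda>\<mu>. Tc \<mu> \<in> {0<..} \<and> Tc \<mu> \<noteq> 0) at_top"
      using eventually_gt_at_top[of "0::real"]
      by eventually_elim (metis Tc(1) greaterThan_iff less_irrefl)
    ultimately have Tc0: "filterlim Tc (at_right 0) at_top"
      by (simp add: filterlim_at)
    let ?L = "2 / pi * (euler_mascheroni + ln (8 / pi) - 2)"
    \<comment> \<open>For \<mu> > 0 this expression is pi / 4 * \<mu> + ln
      (\<open>Tc \<mu>\<close>), so its exponential is
      \<open>Tc \<mu> * exp (pi / 4 * \<mu>)\<close>. The other factor
      \<open>1 + 2 / \<mu> * dimer_A (Tc \<mu>)\<close> of \<open>\<theta>c \<mu>\<close> tends to
      1.\<close>
    have "((\<lambda>\<mu>. pi / 2 * (dimer_J (Tc \<mu>) + 2 / pi * ln (Tc \<mu>))) \<longlongrightarrow> pi / 2 * ?L) at_top"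
      by (intro tendsto_intros filterlim_compose[OF dimer_J_asymptotics Tc0])
    moreover have "pi / 2 * (2 / pi * x) = x" for x by simp
    ultimately have E: "((\<lambda>\<mu>. exp (pi / 2 * (dimer_J (Tc \<mu>) + 2 / pi * ln (Tc \<mu>)))) \<longlongrightarrow> peierls_const) at_top"
      unfolding peierls_const_def by (metis (no_types) tendsto_exp)
    have "((\<lambda>\<mu>::real. 2 / \<mu>) \<longlongrightarrow> 0) at_top" by real_asymp
    note tendsto_mult[OF tendsto_divide[OF E tendsto_const[of peierls_const]] tendsto_add[OF tendsto_const[of 1]
      tendsto_mult[OF this filterlim_compose[OF dimer_A_tendsto Tc0]]]]
    then have lim: "((\<lambda>\<mu>. exp (pi / 2 * (dimer_J (Tc \<mu>) + 2 / pi * ln (Tc \<mu>))) / peierls_const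
        * (1 + 2 / \<mu> * dimer_A (Tc \<mu>))) \<longlongrightarrow> 1) at_top"
      by (simp add: peierls_const_def)
    show "((\<lambda>\<mu>. \<theta>c \<mu> / (peierls_const * exp (- (pi / 4) * \<mu>))) \<longlongrightarrow> 1) at_top"
    proof (rule Lim_transform_eventually[OF lim])
      show "eventually (\<lambda>\<mu>. exp (pi / 2 * (dimer_J (Tc \<mu>) + 2 / pi * ln (Tc \<mu>))) / peierls_const
        * (1 + 2 / \<mu> * dimer_A (Tc \<mu>)) = \<theta>c \<mu> / (peierls_const * exp (- (pi / 4) * \<mu>))) at_top"
        using eventually_gt_at_top[of "0::real"]
      proof eventually_elim
        case (elim \<mu>)
        have a: "pi / 2 * (dimer_J (Tc \<mu>) + 2 / pi * ln (Tc \<mu>)) = pi / 4 * \<mu> + ln (Tc \<mu>)"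
          using Tc(2)[OF elim] by (simp add: field_simps)
        have b: "exp (pi / 4 * \<mu> + ln (Tc \<mu>)) = Tc \<mu> / exp (- (pi / 4) * \<mu>)"
          unfolding exp_add exp_ln[OF Tc(1)[OF elim]] mult_minus_left exp_minus divide_inverse inverse_inverse_eq
          by (rule mult.commute)
        show ?case unfolding a b \<theta>c_def dimer_temp_def by simp
      qed
    qed
  qed
  ultimately show ?thesis using peierls_const_bounds by blast
qed

end
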